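(* There is an algorithm which, given as input the Voronoi tessellation (without its generators) of an unknown finite set $S\subset\mathbb R^2$ of $n$ distinct points, having at least one bounded, strictly interior, non-degenerate cell all of whose neighboring cells are bounded, outputs the generator of every cell of the tessellation, and hence the set $S$, using $\mathcal O(n)$ arithmetic operations in total.
   Context: The Voronoi tessellation of a finite set $S\subset\mathbb R^2$ of distinct points (generators, or sites) partitions the plane into convex cells. The cell of $P\in S$ is the set of points of the plane at least as close (in Euclidean distance) to $P$ as to every other point of $S$, and $P$ is called the generator of that cell. Two cells are adjacent (neighbors) if they share an edge of positive length, called the ridge separating them. A cell is strictly interior if its generator does not lie on the boundary of the convex hull of $S$. A cell is non-degenerate if exactly three cells meet at each of its vertices. Inverse Voronoi problem: given only the tessellation, recover the generators. The tessellation is given combinatorially and geometrically: the list of cells, the adjacency relation between cells with the cyclic order of ridges around each cell, and the exact position of each ridge (its two endpoints if it is bounded, or its endpoint and direction if it is an unbounded ray). Computation is in the real-arithmetic (real RAM) model: each arithmetic operation or comparison on real numbers, and each elementary step of traversing the combinatorial structure, has unit cost. The constant in $\mathcal O(n)$ is absolute. *)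

theory Defs
  imports "HOL-Analysis.Analysis"
begin

section \<open>Voronoi tessellations of finite planar sets\<close>

definition voronoi_cell :: "(real^2) set \<Rightarrow> real^2 \<Rightarrow> (real^2) set" where
  "voronoi_cell S P = {x. \<forall>Q\<in>S. dist x P \<le> dist x Q}"

definition shared_boundary :: "(real^2) set \<Rightarrow> real^2 \<Rightarrow> real^2 \<Rightarrow> (real^2) set" where
  "shared_boundary S P Q = voronoi_cell S P \<inter> voronoi_cell S Q"

definition adjacent :: "(real^2) set \<Rightarrow> real^2 \<Rightarrow> real^2 \<Rightarrow> bool" where
  "adjacent S P Q \<longleftrightarrow> P \<in> S \<and> Q \<in> S \<and> P \<noteq> Q \<and>
     (\<exists>x y. x \<noteq> y \<and> closed_segment x y \<subseteq> shared_boundary S P Q)"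

definition strictly_interior :: "(real^2) set \<Rightarrow> real^2 \<Rightarrow> bool" where
  "strictly_interior S P \<longleftrightarrow> P \<notin> frontier (convex hull S)"

definition nondegenerate_cell :: "(real^2) set \<Rightarrow> real^2 \<Rightarrow> bool" where
  "nondegenerate_cell S P \<longleftrightarrow>
     (\<forall>v. v extreme_point_of voronoi_cell S P \<longrightarrow> card {Q \<in> S. v \<in> voronoi_cell S Q} = 3)"


section \<open>Tessellations without their generators\<close>

text \<open>In \<open>Ray a d\<close> the vector \<open>d\<close> is a direction, not a point; it need not be normalised.
  Ridges that are full lines do not arise here: they force all generators to be collinear,
  and then no cell is bounded.\<close>

datatype ridge_geom = Segment "real^2" "real^2" | Ray "real^2" "real^2"

fun ridge_points :: "ridge_geom \<Rightarrow> (real^2) set" where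
  "ridge_points (Segment a b) = closed_segment a b"
| "ridge_points (Ray a d) = {a + t *\<^sub>R d | t. 0 \<le> t}"

text \<open>\<open>None\<close> is the end at infinity of an unbounded ridge.\<close>

fun ridge_ends :: "ridge_geom \<Rightarrow> (real^2) option set" where
  "ridge_ends (Segment a b) = {Some a, Some b}"
| "ridge_ends (Ray a d) = {Some a, None}"

record ridge =
  side1 :: nat
  side2 :: nat
  geom :: ridge_geom

text \<open>Cells and ridges are numbered by their positions in the two lists; \<open>cells T ! i\<close> lists the
  numbers of the ridges of cell \<open>i\<close> in cyclic order.\<close>

record tessellation =
  cells :: "nat list list"
  ridges :: "ridge list"

text \<open>In a cyclic traversal of the boundary of a cell, successive ridges have a common vertex,
  or they are the two rays of an unbounded cell and have the common end \<open>None\<close>. Each end is shared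
  by exactly two ridges of the cell, so this fixes the cyclic order up to the sense of traversal
  and the starting ridge; both may be chosen independently for each cell.\<close>

definition cyclic_order :: "ridge list \<Rightarrow> nat list \<Rightarrow> bool" where
  "cyclic_order rs c \<longleftrightarrow>
     (\<forall>k < length c. ridge_ends (geom (rs ! (c ! k))) \<inter>
                     ridge_ends (geom (rs ! (c ! (Suc k mod length c)))) \<noteq> {})"

text \<open>\<open>T\<close> describes the Voronoi tessellation of \<open>S\<close>, where \<open>p i\<close> is the generator of cell
  \<open>i\<close>. The numbering of cells and ridges and the order of the two sides of a ridge are
  arbitrary.\<close>

definition describes_voronoi :: "tessellation \<Rightarrow> (real^2) set \<Rightarrow> (nat \<Rightarrow> real^2) \<Rightarrow> bool" where
  "describes_voronoi T S p \<longleftrightarrow>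
     bij_betw p {..<length (cells T)} S \<and>
     (\<forall>r \<in> set (ridges T).
        side1 r < length (cells T) \<and> side2 r < length (cells T) \<and>
        adjacent S (p (side1 r)) (p (side2 r)) \<and>
        ridge_points (geom r) = shared_boundary S (p (side1 r)) (p (side2 r))) \<and>
     (\<forall>i < length (cells T). \<forall>j < length (cells T). adjacent S (p i) (p j) \<longrightarrow>
        (\<exists>!k. k < length (ridges T) \<and> {side1 (ridges T ! k), side2 (ridges T ! k)} = {i, j})) \<and>
     (\<forall>i < length (cells T).
        distinct (cells T ! i) \<and>
        set (cells T ! i) =
          {k. k < length (ridges T) \<and> i \<in> {side1 (ridges T ! k), side2 (ridges T ! k)}} \<and>
        cyclic_order (ridges T) (cells T ! i))"


section \<open>A real RAM\<close>

text \<open>Programs of the real RAM, in structured form. The memory consists of named arrays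
  of natural numbers (indices and pointers) and of real numbers; a scalar is entry 0 of an array.
  Reals admit the four field operations and comparisons. There are no roots and no rounding, and
  programs contain only integer constants. Indices can be added, subtracted (with truncation) and
  compared. Division by zero gives zero, which a program could equally obtain by a test.\<close>

record state =
  nats :: "string \<Rightarrow> nat \<Rightarrow> nat"
  reals :: "string \<Rightarrow> nat \<Rightarrow> real"

datatype nexp =
    NConst nat
  | NGet string nexp
  | NAdd nexp nexp
  | NSub nexp nexp

datatype rexp =
    RConst int
  | RGet string nexp
  | RAdd rexp rexp
  | RSub rexp rexp
  | RMul rexp rexp
  | RDiv rexp rexp

datatype test =
    NLess nexp nexp
  | NEq nexp nexp
  | RLess rexp rexp
  | REq rexp rexp
  | Neg test
  | Conj test test

datatype com =
    Skip
  | NSet string nexp nexp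
  | RSet string nexp rexp
  | Seq com com
  | Cond test com com
  | While test com

primrec nval :: "nexp \<Rightarrow> state \<Rightarrow> nat" where
  "nval (NConst k) s = k"
| "nval (NGet a e) s = nats s a (nval e s)"
| "nval (NAdd e f) s = nval e s + nval f s"
| "nval (NSub e f) s = nval e s - nval f s"

primrec rval :: "rexp \<Rightarrow> state \<Rightarrow> real" where
  "rval (RConst z) s = of_int z"
| "rval (RGet a e) s = reals s a (nval e s)"
| "rval (RAdd e f) s = rval e s + rval f s"
| "rval (RSub e f) s = rval e s - rval f s"
| "rval (RMul e f) s = rval e s * rval f s"
| "rval (RDiv e f) s = rval e s / rval f s"

primrec holds :: "test \<Rightarrow> state \<Rightarrow> bool" where
  "holds (NLess e f) s \<longleftrightarrow> nval e s < nval f s"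
| "holds (NEq e f) s \<longleftrightarrow> nval e s = nval f s"
| "holds (RLess e f) s \<longleftrightarrow> rval e s < rval f s"
| "holds (REq e f) s \<longleftrightarrow> rval e s = rval f s"
| "holds (Neg b) s \<longleftrightarrow> \<not> holds b s"
| "holds (Conj b c) s \<longleftrightarrow> holds b s \<and> holds c s"

text \<open>Every constant, memory access, operation and comparison costs one unit.\<close>

primrec ncost :: "nexp \<Rightarrow> nat" where
  "ncost (NConst k) = 1"
| "ncost (NGet a e) = ncost e + 1"
| "ncost (NAdd e f) = ncost e + ncost f + 1"
| "ncost (NSub e f) = ncost e + ncost f + 1"

primrec rcost :: "rexp \<Rightarrow> nat" where
  "rcost (RConst z) = 1"
| "rcost (RGet a e) = ncost e + 1"
| "rcost (RAdd e f) = rcost e + rcost f + 1"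
| "rcost (RSub e f) = rcost e + rcost f + 1"
| "rcost (RMul e f) = rcost e + rcost f + 1"
| "rcost (RDiv e f) = rcost e + rcost f + 1"

primrec tcost :: "test \<Rightarrow> nat" where
  "tcost (NLess e f) = ncost e + ncost f + 1"
| "tcost (NEq e f) = ncost e + ncost f + 1"
| "tcost (RLess e f) = rcost e + rcost f + 1"
| "tcost (REq e f) = rcost e + rcost f + 1"
| "tcost (Neg b) = tcost b + 1"
| "tcost (Conj b c) = tcost b + tcost c + 1"

text \<open>\<open>exec c s t s'\<close>: started in \<open>s\<close>, program \<open>c\<close> halts in \<open>s'\<close> at total cost \<open>t\<close>.\<close>

inductive exec :: "com \<Rightarrow> state \<Rightarrow> nat \<Rightarrow> state \<Rightarrow> bool" where
  Skip: "exec Skip s 1 s"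
| NSet: "exec (NSet a e f) s (ncost e + ncost f + 1)
           (s\<lparr>nats := (nats s)(a := (nats s a)(nval e s := nval f s))\<rparr>)"
| RSet: "exec (RSet a e f) s (ncost e + rcost f + 1)
           (s\<lparr>reals := (reals s)(a := (reals s a)(nval e s := rval f s))\<rparr>)"
| Seq: "exec c s t s' \<Longrightarrow> exec d s' u s'' \<Longrightarrow> exec (Seq c d) s (t + u) s''"
| CondTrue: "holds b s \<Longrightarrow> exec c s t s' \<Longrightarrow> exec (Cond b c d) s (tcost b + t + 1) s'"
| CondFalse: "\<not> holds b s \<Longrightarrow> exec d s t s' \<Longrightarrow> exec (Cond b c d) s (tcost b + t + 1) s'"
| WhileTrue: "holds b s \<Longrightarrow> exec c s t s' \<Longrightarrow> exec (While b c) s' u s'' \<Longrightarrow>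
    exec (While b c) s (tcost b + t + u + 1) s''"
| WhileFalse: "\<not> holds b s \<Longrightarrow> exec (While b c) s (tcost b + 1) s"

lemma exec_deterministic:
  "exec c s t s' \<Longrightarrow> exec c s u s'' \<Longrightarrow> t = u \<and> s' = s''"
proof (induction arbitrary: u s'' rule: exec.induct)
  case (WhileTrue b s c t s' u' s3)
  from WhileTrue.prems WhileTrue.hyps(1) obtain t1 s1 u1 where
    "u = tcost b + t1 + u1 + 1" "exec c s t1 s1" "exec (While b c) s1 u1 s''"
    by (cases rule: exec.cases) auto
  with WhileTrue.IH show ?case by blast
next
  case (Seq c s t s' d u' s3)
  from Seq.prems obtain t1 s1 u1 where
    "u = t1 + u1" "exec c s t1 s1" "exec d s1 u1 s''"
    by (cases rule: exec.cases) auto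
  with Seq.IH show ?case by blast
qed (erule exec.cases; fastforce)+


section \<open>Input and output conventions\<close>

definition array :: "'a::zero list \<Rightarrow> nat \<Rightarrow> 'a" where
  "array xs i = (if i < length xs then xs ! i else 0)"

fun is_ray :: "ridge_geom \<Rightarrow> nat" where
  "is_ray (Segment a b) = 0"
| "is_ray (Ray a d) = 1"

fun geom_vec1 :: "ridge_geom \<Rightarrow> real^2" where
  "geom_vec1 (Segment a b) = a"
| "geom_vec1 (Ray a d) = a"

fun geom_vec2 :: "ridge_geom \<Rightarrow> real^2" where
  "geom_vec2 (Segment a b) = b"
| "geom_vec2 (Ray a d) = d"

text \<open>The ridge lists of the cells are stored one after the other in \<open>''cell_ridges''\<close>; the list of
  cell \<open>i\<close> starts at position \<open>''cell_start''[i]\<close> and ends before \<open>''cell_start''[i + 1]\<close>.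
  All memory not holding input is zero.\<close>

definition input_state :: "tessellation \<Rightarrow> state" where
  "input_state T = \<lparr>
     nats = (\<lambda>_ _. 0)(
       ''num_cells'' := array [length (cells T)],
       ''num_ridges'' := array [length (ridges T)],
       ''cell_start'' := array (map (\<lambda>i. length (concat (take i (cells T))))
                                  [0..<Suc (length (cells T))]),
       ''cell_ridges'' := array (concat (cells T)),
       ''side1'' := array (map side1 (ridges T)),
       ''side2'' := array (map side2 (ridges T)),
       ''is_ray'' := array (map (is_ray \<circ> geom) (ridges T))),
     reals = (\<lambda>_ _. 0)(
       ''x1'' := array (map (\<lambda>r. geom_vec1 (geom r) $ 1) (ridges T)),
       ''y1'' := array (map (\<lambda>r. geom_vec1 (geom r) $ 2) (ridges T)),
       ''x2'' := array (map (\<lambda>r. geom_vec2 (geom r) $ 1) (ridges T)),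
       ''y2'' := array (map (\<lambda>r. geom_vec2 (geom r) $ 2) (ridges T)))\<rparr>"

definition output_point :: "state \<Rightarrow> nat \<Rightarrow> real^2" where
  "output_point s i = vector [reals s ''gen_x'' i, reals s ''gen_y'' i]"

end

theory Submission
  imports Defs
begin

text \<open>The reflection in the line of a ridge exchanges the two generators on its sides. So one generator
  determines all others: the adjacency graph is connected, because the closest pair across any
  partition of the sites is adjacent (\<open>adjacent_crossing\<close>), and reflections carry a known generator
  along it.

  A first generator comes from closed chains of reflections. If three cells with generators
  \<open>P\<close>, \<open>Q\<close>, \<open>R\<close> are pairwise adjacent, the reflections taking \<open>P\<close> to \<open>Q\<close> to \<open>R\<close> and back to \<open>P\<close>
  compose to a map that fixes \<open>P\<close>. With points as complex numbers it has the form
  \<open>z \<mapsto> a + u * cnj z\<close>, with \<open>a\<close> and \<open>u\<close> rational in the coordinates of the ridges, so that two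
  chains with different \<open>u\<close> give \<open>P\<close> by one division (\<open>solve_generator\<close>). Every solution found in
  this way is correct, whichever ridge it comes from. That one is found is ensured by the
  nondegenerate bounded cell: at both ends of any of its ridges exactly three cells meet, the third
  cells at the two ends give two chains, and equal \<open>u\<close> would make both ends collinear with \<open>P\<close>,
  which does not lie on the line of the ridge (\<open>turns_differ\<close>, \<open>ex_seed_ridge\<close>). The cyclic orders
  around the two sides of a ridge supply the candidates for the third cells in constant time, so the
  test is made at every ridge.

  It remains that there are only linearly many ridges. Fix a direction in which no two sites
  are level. At an end \<open>v\<close> of a ridge there are at least three nearest sites, all on one circle around
  \<open>v\<close>; a site \<open>M\<close> among them that is neither the first nor the last in the chosen direction has \<open>v\<close> as
  the top or the bottom of its cell (\<open>between_extremal\<close>). Hence \<open>M\<close> and one bit determine \<open>v\<close>, and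
  charging the ridge to a suitable \<open>M\<close> leaves boundedly many ridges per site (\<open>card_ridge_ends\<close>).

  The program is a sequence of loops with loop-free bodies. The cost of a body has a syntactic
  bound, so the time analysis reduces to counting iterations (\<open>runs_While\<close>).\<close>

section \<open>Voronoi cells near a point\<close>

text \<open>The sites of \<open>nearest S v\<close> lie on a circle around \<open>v\<close>. Near \<open>v\<close> the tessellation depends only on
  them: the cell of \<open>P\<close> is there the cone of all directions \<open>w\<close> with \<open>w \<bullet> (R - P) \<le> 0\<close> for every
  nearest \<open>R\<close>.\<close>

definition nearest :: "(real^2) set \<Rightarrow> real^2 \<Rightarrow> (real^2) set" where
  "nearest S v = {R \<in> S. v \<in> voronoi_cell S R}"

definition cross2 :: "real^2 \<Rightarrow> real^2 \<Rightarrow> real" where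
  "cross2 x y = x $ 1 * y $ 2 - x $ 2 * y $ 1"

definition rot :: "real^2 \<Rightarrow> real^2" where
  "rot x = vector [- x $ 2, x $ 1]"

lemma inner_2: "x \<bullet> y = x $ 1 * y $ 1 + x $ 2 * y $ 2" for x y :: "real^2"
  by (simp add: inner_vec_def sum_2)

lemma rot_nth [simp]: "rot x $ 1 = - x $ 2" "rot x $ 2 = x $ 1"
  by (simp_all add: rot_def)

lemma rot_inner: "rot x \<bullet> y = cross2 x y"
  by (simp add: inner_2 cross2_def)

lemma vec2_eq_iff: "x = y \<longleftrightarrow> x $ 1 = y $ 1 \<and> x $ 2 = y $ 2" for x y :: "real^2"
  by (simp add: vec_eq_iff forall_2)

lemma rot_eq_0 [simp]: "rot x = 0 \<longleftrightarrow> x = 0"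
  by (auto simp: vec2_eq_iff)

lemma dist_le_iff: "dist x P \<le> dist x Q \<longleftrightarrow> 2 * (x \<bullet> (Q - P)) \<le> Q \<bullet> Q - P \<bullet> P"
  for x P Q :: "'a::real_inner"
  unfolding dist_norm norm_le by (auto simp: inner_diff inner_commute)

lemma dist_eq_iff: "dist x P = dist x Q \<longleftrightarrow> 2 * (x \<bullet> (Q - P)) = Q \<bullet> Q - P \<bullet> P"
  for x P Q :: "'a::real_inner"
  unfolding dist_norm norm_eq by (auto simp: inner_diff inner_commute)

lemma dist_le_iff_from:
  fixes x v P Q :: "'a::real_inner"
  assumes "dist v P = dist v Q"
  shows "dist x P \<le> dist x Q \<longleftrightarrow> (x - v) \<bullet> (Q - P) \<le> 0"
  using assms unfolding dist_eq_iff dist_le_iff by (auto simp: inner_diff_left)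

lemma nearest_dist_eq:
  assumes "P \<in> nearest S v" "Q \<in> nearest S v"
  shows "dist v P = dist v Q"
  using assms by (force simp: nearest_def voronoi_cell_def intro: antisym)

lemma nearestI:
  assumes "P \<in> nearest S v" "R \<in> S" "dist v R = dist v P"
  shows "R \<in> nearest S v"
  using assms by (auto simp: nearest_def voronoi_cell_def)

lemma parallel_if_perp:
  fixes q r w :: "real^2"
  assumes "w \<noteq> 0" "w \<bullet> q = 0" "w \<bullet> r = 0"
  shows "cross2 q r = 0"
proof -
  have *: "w $ 1 * q $ 1 = - (w $ 2 * q $ 2)" "w $ 1 * r $ 1 = - (w $ 2 * r $ 2)"
    using assms by (auto simp: inner_2)
  have "w $ 1 * cross2 q r = 0" "w $ 2 * cross2 q r = 0"
    using * unfolding cross2_def by algebra+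
  with \<open>w \<noteq> 0\<close> show ?thesis by (auto simp: vec2_eq_iff)
qed

lemma cross2_eq_0_scale:
  assumes "cross2 q r = 0" "q \<noteq> 0"
  obtains c where "r = c *\<^sub>R q"
proof (cases "q $ 1 = 0")
  case True
  with assms have "q $ 2 \<noteq> 0" by (auto simp: vec2_eq_iff)
  with True assms show ?thesis
    by (intro that[of "r $ 2 / q $ 2"]) (auto simp: vec2_eq_iff cross2_def)
next
  case False
  with assms show ?thesis
    by (intro that[of "r $ 1 / q $ 1"]) (auto simp: vec2_eq_iff cross2_def field_simps)
qed

text \<open>A line meets a circle in at most two points.\<close>

lemma circle_not_collinear:
  assumes "dist v P = dist v Q" "dist v P = dist v R" "P \<noteq> Q" "P \<noteq> R" "Q \<noteq> R"
  shows "cross2 (Q - P) (R - P) \<noteq> 0"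
proof
  assume "cross2 (Q - P) (R - P) = 0"
  then obtain c where c: "R - P = c *\<^sub>R (Q - P)"
    using assms cross2_eq_0_scale[of "Q - P" "R - P"] by auto
  have chord: "(Q - P) \<bullet> (Q - P) = 2 * ((v - P) \<bullet> (Q - P))" if "dist v P = dist v Q" for Q
    using that unfolding dist_eq_iff by (simp add: inner_diff inner_commute)
  have "c * c * ((Q - P) \<bullet> (Q - P)) = (R - P) \<bullet> (R - P)" by (simp add: c)
  also have "\<dots> = 2 * ((v - P) \<bullet> (c *\<^sub>R (Q - P)))"
    by (metis chord c assms(2))
  also have "\<dots> = c * ((Q - P) \<bullet> (Q - P))"
    using chord[OF assms(1)] by simp
  finally have "c = 0 \<or> c = 1" using assms by auto
  then show False using c assms by auto
qed



text \<open>Moving from \<open>v\<close> in a direction along the bisector of \<open>P\<close> and \<open>Q\<close> and away from the other nearest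
  sites stays in both cells for a while: the sites that are not nearest to \<open>v\<close> are farther by a
  positive amount, and there are finitely many of them.\<close>

lemma ridge_germ:
  assumes "finite S" "P \<in> nearest S v" "Q \<in> nearest S v" "w \<bullet> (Q - P) = 0"
    and away: "\<And>R. R \<in> nearest S v \<Longrightarrow> R \<noteq> P \<Longrightarrow> R \<noteq> Q \<Longrightarrow> w \<bullet> (R - P) < 0"
  shows "\<forall>\<^sub>F t in at_right 0. v + t *\<^sub>R w \<in> shared_boundary S P Q"
proof -
  have "\<forall>\<^sub>F t in at_right 0. dist (v + t *\<^sub>R w) P \<le> dist (v + t *\<^sub>R w) R" if "R \<in> S" for R
  proof (cases "R \<in> nearest S v")
    case True
    have "\<forall>\<^sub>F t::real in at_right 0. 0 < t"
      by (simp add: eventually_at_right_less)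
    then show ?thesis
    proof eventually_elim
      case (elim t)
      have "w \<bullet> (R - P) \<le> 0" using away[OF True] assms(4) by force
      with elim show ?case
        using nearest_dist_eq[OF assms(2) True]
        by (simp add: dist_le_iff_from mult_nonneg_nonpos)
    qed
  next
    case False
    then have "dist v P < dist v R"
      using assms(2) \<open>R \<in> S\<close> nearestI[OF assms(2), of R]
      by (force simp: nearest_def voronoi_cell_def)
    moreover have "((\<lambda>t. dist (v + t *\<^sub>R w) R - dist (v + t *\<^sub>R w) P) \<longlongrightarrow>
        dist (v + 0 *\<^sub>R w) R - dist (v + 0 *\<^sub>R w) P) (at_right 0)"
      by (intro tendsto_intros)
    ultimately have "\<forall>\<^sub>F t in at_right 0. 0 < dist (v + t *\<^sub>R w) R - dist (v + t *\<^sub>R w) P"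
      by (intro order_tendstoD) auto
    then show ?thesis by eventually_elim simp
  qed
  with \<open>finite S\<close> have "\<forall>\<^sub>F t in at_right 0. \<forall>R\<in>S. dist (v + t *\<^sub>R w) P \<le> dist (v + t *\<^sub>R w) R"
    by (simp add: eventually_ball_finite)
  then show ?thesis
  proof eventually_elim
    case (elim t)
    have "dist (v + t *\<^sub>R w) P = dist (v + t *\<^sub>R w) Q"
      using nearest_dist_eq[OF assms(2,3)] assms(4) unfolding dist_eq_iff
      by (simp add: inner_add_left)
    with elim show ?case by (simp add: shared_boundary_def voronoi_cell_def)
  qed
qed

lemma shared_perp:
  assumes "P \<in> S" "Q \<in> S" "x \<in> shared_boundary S P Q" "y \<in> shared_boundary S P Q"
  shows "(x - y) \<bullet> (Q - P) = 0"
proof -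
  have "dist x P = dist x Q" "dist y P = dist y Q"
    using assms by (auto simp: shared_boundary_def voronoi_cell_def intro: antisym)
  then show ?thesis by (simp add: dist_eq_iff inner_diff_left)
qed

lemma shared_nearest:
  assumes "P \<in> S" "Q \<in> S" "v \<in> shared_boundary S P Q"
  shows "P \<in> nearest S v" "Q \<in> nearest S v"
  using assms by (auto simp: nearest_def shared_boundary_def)

lemma voronoi_cell_convex: "convex (voronoi_cell S P)"
proof -
  have "voronoi_cell S P = (\<Inter>Q\<in>S. {x. (2 *\<^sub>R (Q - P)) \<bullet> x \<le> Q \<bullet> Q - P \<bullet> P})"
    by (auto simp: voronoi_cell_def dist_le_iff inner_commute)
  then show ?thesis by (simp only:) (intro convex_INT convex_halfspace_le)
qed

lemma adjacent_germ:
  assumes "finite S" "P \<in> nearest S v" "Q \<in> nearest S v" "P \<noteq> Q" "w \<noteq> 0" "w \<bullet> (Q - P) = 0"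
    and "\<And>R. R \<in> nearest S v \<Longrightarrow> R \<noteq> P \<Longrightarrow> R \<noteq> Q \<Longrightarrow> w \<bullet> (R - P) < 0"
  shows "adjacent S P Q"
proof -
  have "\<forall>\<^sub>F t in at_right 0. v + t *\<^sub>R w \<in> shared_boundary S P Q \<and> 0 < t"
    using ridge_germ[OF assms(1-3,6,7)] by (auto simp: eventually_at_right_less eventually_conj_iff)
  then obtain t where t: "v + t *\<^sub>R w \<in> shared_boundary S P Q" "0 < t"
    by (force dest: eventually_happens)
  have "v \<in> shared_boundary S P Q" "P \<in> S" "Q \<in> S"
    using assms by (auto simp: nearest_def shared_boundary_def)
  moreover have "convex (shared_boundary S P Q)"
    by (simp add: shared_boundary_def convex_Int voronoi_cell_convex)
  ultimately have "closed_segment v (v + t *\<^sub>R w) \<subseteq> shared_boundary S P Q"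
    using t by (simp add: closed_segment_subset)
  with t assms show ?thesis
    unfolding adjacent_def using \<open>P \<in> S\<close> \<open>Q \<in> S\<close>
    by (intro conjI exI[of _ v] exI[of _ "v + t *\<^sub>R w"]) auto
qed

text \<open>A closest pair across the partition is adjacent at its midpoint. A site in the disc with diameter
  \<open>P Q\<close> would lie on one side of the partition and be closer to the point on the other side.\<close>

lemma adjacent_crossing:
  assumes "finite S" "A \<subseteq> S" "A \<noteq> {}" "A \<noteq> S"
  obtains P Q where "P \<in> A" "Q \<in> S - A" "adjacent S P Q"
proof -
  let ?D = "(\<lambda>(P,Q). dist P Q) ` (A \<times> (S - A))"
  have "finite (A \<times> (S - A))" "A \<times> (S - A) \<noteq> {}"
    using assms finite_subset[of A S] by auto
  then obtain PQ where PQ: "PQ \<in> A \<times> (S - A)"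
    "\<And>x. x \<in> A \<times> (S - A) \<Longrightarrow> case_prod dist PQ \<le> case_prod dist x"
    using ex_min_if_finite[of ?D] by (force simp: not_less)
  obtain P Q where [simp]: "PQ = (P, Q)" by force
  from PQ have P: "P \<in> A" and Q: "Q \<in> S - A"
    and min: "\<And>P' Q'. P' \<in> A \<Longrightarrow> Q' \<in> S - A \<Longrightarrow> dist P Q \<le> dist P' Q'"
    by auto
  \<comment> \<open>the disc with diameter \<open>P Q\<close> contains no third site\<close>
  define m where "m = midpoint P Q"
  have far: "dist m P < dist m R" if "R \<in> S" "R \<noteq> P" "R \<noteq> Q" for R
  proof (rule ccontr)
    assume "\<not> dist m P < dist m R"
    then have "dist m R \<le> dist m P" by simp
    then have le: "(R - P) \<bullet> (R - Q) \<le> 0"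
      by (simp add: dist_le_iff m_def midpoint_def inner_diff inner_add inner_commute algebra_simps)
    have "(R - P) \<bullet> (R - P) > 0" "(R - Q) \<bullet> (R - Q) > 0" using that by auto
    with le have "(R - P) \<bullet> (R - P) < (P - Q) \<bullet> (P - Q)" "(R - Q) \<bullet> (R - Q) < (P - Q) \<bullet> (P - Q)"
      by (simp_all add: inner_diff inner_commute)
    then have "dist R P < dist P Q" "dist R Q < dist P Q"
      by (simp_all add: dist_norm norm_lt)
    with min[of R Q] min[of P R] P Q that show False
      by (auto simp: dist_commute)
  qed
  have eq: "dist m P = dist m Q" by (simp add: m_def dist_midpoint)
  have near: "nearest S m = {P, Q}"
  proof -
    have "dist m P \<le> dist m R" if "R \<in> S" for R using far[OF that] eq by force
    moreover have "R = P \<or> R = Q" if "R \<in> S" "dist m R \<le> dist m P" for R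
      using far that by force
    ultimately show ?thesis using P Q assms eq
      unfolding nearest_def voronoi_cell_def by auto
  qed
  have "adjacent S P Q"
    using P Q near assms(1)
    by (intro adjacent_germ[of S P m Q "rot (Q - P)"]) (auto simp: rot_inner cross2_def)
  with that P Q show ?thesis by blast
qed


text \<open>The vector \<open>w\<close> leads from the end \<open>v\<close> into the ridge. It is an outer normal of the chord \<open>P Q\<close> in
  the circle of the sites nearest to \<open>v\<close> (\<open>ridge_end_away\<close>).\<close>

definition ridge_end :: "(real^2) set \<Rightarrow> real^2 \<Rightarrow> real^2 \<Rightarrow> real^2 \<Rightarrow> real^2 \<Rightarrow> bool" where
  "ridge_end S P Q v w \<longleftrightarrow> P \<in> S \<and> Q \<in> S \<and> P \<noteq> Q \<and> w \<noteq> 0 \<and>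
     v \<in> shared_boundary S P Q \<and> v + w \<in> shared_boundary S P Q \<and>
     (\<forall>t>0. v - t *\<^sub>R w \<notin> shared_boundary S P Q)"

lemma ridge_end_sym: "ridge_end S P Q v w \<longleftrightarrow> ridge_end S Q P v w"
  by (auto simp: ridge_end_def shared_boundary_def Int_commute)

lemma ridge_end_perp: "ridge_end S P Q v w \<Longrightarrow> w \<bullet> (Q - P) = 0"
  using shared_perp[of P S Q "v + w" v] by (simp add: ridge_end_def)

lemma ridge_end_nearest:
  assumes "ridge_end S P Q v w"
  shows "P \<in> nearest S v" "Q \<in> nearest S v"
  using assms shared_nearest by (auto simp: ridge_end_def)

text \<open>Otherwise the ridge would continue beyond its end.\<close>

lemma ridge_end_third:
  assumes "finite S" "ridge_end S P Q v w"
  obtains R where "R \<in> nearest S v" "R \<noteq> P" "R \<noteq> Q"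
proof (rule ccontr)
  assume "\<not> thesis"
  with that have *: "R = P \<or> R = Q" if "R \<in> nearest S v" for R using \<open>R \<in> nearest S v\<close> by blast
  have "\<forall>\<^sub>F t in at_right 0. v + t *\<^sub>R (- w) \<in> shared_boundary S P Q"
    using ridge_end_perp[OF assms(2)] ridge_end_nearest[OF assms(2)] *
    by (intro ridge_germ[OF assms(1)]) auto
  then have "\<forall>\<^sub>F t in at_right 0. v + t *\<^sub>R (- w) \<in> shared_boundary S P Q \<and> 0 < t"
    by (auto simp: eventually_at_right_less eventually_conj_iff)
  then obtain t where "v + t *\<^sub>R (- w) \<in> shared_boundary S P Q" "0 < t"
    by (force dest: eventually_happens)
  with assms(2) show False by (auto simp: ridge_end_def)
qed

lemma nearest_not_collinear:
  assumes "P \<in> nearest S v" "Q \<in> nearest S v" "R \<in> nearest S v" "P \<noteq> Q" "P \<noteq> R" "Q \<noteq> R"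
  shows "cross2 (Q - P) (R - P) \<noteq> 0"
  using assms by (intro circle_not_collinear nearest_dist_eq)

lemma ridge_end_away:
  assumes "ridge_end S P Q v w" "R \<in> nearest S v" "R \<noteq> P" "R \<noteq> Q"
  shows "w \<bullet> (R - P) < 0"
proof -
  note N = ridge_end_nearest[OF assms(1)]
  have "dist (v + w) P \<le> dist (v + w) R"
    using assms by (auto simp: ridge_end_def shared_boundary_def voronoi_cell_def nearest_def)
  then have "w \<bullet> (R - P) \<le> 0"
    using nearest_dist_eq[OF N(1) assms(2)] by (simp add: dist_le_iff_from)
  moreover have "cross2 (Q - P) (R - P) \<noteq> 0"
    using N assms by (intro nearest_not_collinear[of _ S v]) (auto simp: ridge_end_def)
  then have "w \<bullet> (R - P) \<noteq> 0"
    using parallel_if_perp[OF _ ridge_end_perp[OF assms(1)], of "R - P"] assms(1)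
    by (auto simp: ridge_end_def)
  ultimately show ?thesis by simp
qed

lemma perp_both_0:
  assumes "cross2 q r \<noteq> 0" "x \<bullet> q = 0" "x \<bullet> r = 0"
  shows "x = 0"
  using assms parallel_if_perp[of x q r] by argo

text \<open>Each of \<open>Q\<close> and \<open>R\<close> confines the cell of \<open>P\<close> to a half-plane through \<open>v\<close>. A segment in the cell
  with \<open>v\<close> inside lies on both boundary lines, and these meet only in \<open>v\<close>.\<close>

lemma three_nearest_extreme:
  assumes "P \<in> nearest S v" "Q \<in> nearest S v" "R \<in> nearest S v" "P \<noteq> Q" "P \<noteq> R" "Q \<noteq> R"
  shows "v extreme_point_of voronoi_cell S P"
  unfolding extreme_point_of_def
proof (intro conjI ballI notI)
  show "v \<in> voronoi_cell S P" using assms by (simp add: nearest_def)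
next
  fix x y assume x: "x \<in> voronoi_cell S P" and y: "y \<in> voronoi_cell S P"
    and "v \<in> open_segment x y"
  then obtain u where u: "0 < u" "u < 1" "v = (1 - u) *\<^sub>R x + u *\<^sub>R y" and "x \<noteq> y"
    by (auto simp: in_segment)
  have perp: "(x - v) \<bullet> (Q - P) = 0" if "Q \<in> nearest S v" for Q
  proof -
    have "Q \<in> S" using that by (simp add: nearest_def)
    then have "dist x P \<le> dist x Q" "dist y P \<le> dist y Q"
      using x y by (simp_all add: voronoi_cell_def)
    then have le: "(x - v) \<bullet> (Q - P) \<le> 0" "(y - v) \<bullet> (Q - P) \<le> 0"
      using nearest_dist_eq[OF assms(1) that] by (simp_all add: dist_le_iff_from)
    have "(1 - u) *\<^sub>R (x - v) + u *\<^sub>R (y - v) = 0"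
      using u(3) by (simp add: algebra_simps)
    then have "(1 - u) * ((x - v) \<bullet> (Q - P)) + u * ((y - v) \<bullet> (Q - P)) = 0"
      by (simp flip: inner_scaleR_left inner_add_left)
    moreover have "u * ((y - v) \<bullet> (Q - P)) \<le> 0" using u le by (simp add: mult_nonneg_nonpos)
    ultimately have "0 \<le> (1 - u) * ((x - v) \<bullet> (Q - P))" by linarith
    with u le show ?thesis by (simp add: zero_le_mult_iff)
  qed
  have xv: "x - v = 0"
    using perp assms by (intro perp_both_0[OF nearest_not_collinear[OF assms]]) auto
  have "u *\<^sub>R (y - x) = v - x" by (simp add: u(3) algebra_simps)
  also have "\<dots> = 0" using xv by simp
  finally have "u *\<^sub>R (y - x) = 0" .
  with u \<open>x \<noteq> y\<close> show False by simp
qed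

text \<open>The bisector of \<open>P\<close> and \<open>R\<close> has a direction that leads away from \<open>Q\<close>, because the three points
  are not collinear.\<close>

lemma three_nearest_adjacent:
  assumes "finite S" "nearest S v = {P, Q, R}" "P \<noteq> Q" "P \<noteq> R" "Q \<noteq> R"
  shows "adjacent S P R"
proof -
  have N: "P \<in> nearest S v" "Q \<in> nearest S v" "R \<in> nearest S v"
    "\<And>A. A \<in> nearest S v \<Longrightarrow> A \<noteq> P \<Longrightarrow> A \<noteq> R \<Longrightarrow> A = Q"
    unfolding assms(2) by blast+
  have c: "cross2 (R - P) (Q - P) \<noteq> 0"
    using N(1,3,2) assms(3-5) by (intro nearest_not_collinear[of _ S v]) auto
  \<comment> \<open>the sense of the normal that points away from \<open>Q\<close>\<close>
  define w where "w = (if cross2 (R - P) (Q - P) < 0 then rot (R - P) else - rot (R - P))"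
  have "w \<bullet> (Q - P) < 0" "w \<bullet> (R - P) = 0" "w \<noteq> 0"
    using c assms(4) by (auto simp: w_def rot_inner) (auto simp: cross2_def)
  with N assms(1,4) show ?thesis by (intro adjacent_germ[of S P v R w]) auto
qed

section \<open>The number of ridges is linear\<close>

text \<open>The chord \<open>P Q\<close> is a side of the convex polygon spanned by the sites nearest to \<open>v\<close>.\<close>

lemma ridge_end_same_side:
  assumes "ridge_end S P Q v w"
    and "R \<in> nearest S v" "R \<noteq> P" "R \<noteq> Q" "R' \<in> nearest S v" "R' \<noteq> P" "R' \<noteq> Q"
  shows "0 < cross2 (Q - P) (R - P) * cross2 (Q - P) (R' - P)"
proof -
  have "cross2 (rot (Q - P)) w = 0" "Q \<noteq> P"
    using ridge_end_perp[OF assms(1)] assms(1)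
    by (auto simp: inner_2 cross2_def algebra_simps ridge_end_def)
  then obtain c where c: "w = c *\<^sub>R rot (Q - P)"
    using cross2_eq_0_scale[of "rot (Q - P)" w] by auto
  have "0 < (w \<bullet> (R - P)) * (w \<bullet> (R' - P))"
    using ridge_end_away[OF assms(1)] assms(2-) by (intro mult_neg_neg)
  also have "\<dots> = c\<^sup>2 * (cross2 (Q - P) (R - P) * cross2 (Q - P) (R' - P))"
    by (simp add: c rot_inner power2_eq_square)
  finally show ?thesis by (simp add: zero_less_mult_iff)
qed

lemma card_le_2_if_no_three:
  assumes "\<And>x y z. x \<in> A \<Longrightarrow> y \<in> A \<Longrightarrow> z \<in> A \<Longrightarrow> x \<noteq> y \<Longrightarrow> x \<noteq> z \<Longrightarrow> y \<noteq> z \<Longrightarrow> False"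
  shows "card A \<le> 2"
proof (rule ccontr)
  assume "\<not> card A \<le> 2"
  then have "3 \<le> card A" by simp
  then obtain B where "B \<subseteq> A" "card B = 3" by (rule obtain_subset_with_card_n)
  then show False using assms by (auto simp: card_3_iff)
qed

text \<open>Seen from \<open>P\<close>, one of three other corners of a convex polygon is between the two others, and the
  chord to it separates them. In terms of orientations the three conditions on the signs of the cross
  products contradict each other.\<close>

lemma ridge_end_at_most_two: "card {Q. \<exists>w. ridge_end S P Q v w} \<le> 2"
proof (rule card_le_2_if_no_three)
  fix Q1 Q2 Q3
  assume "Q1 \<in> {Q. \<exists>w. ridge_end S P Q v w}" "Q2 \<in> {Q. \<exists>w. ridge_end S P Q v w}"
    "Q3 \<in> {Q. \<exists>w. ridge_end S P Q v w}"
    and ne: "Q1 \<noteq> Q2" "Q1 \<noteq> Q3" "Q2 \<noteq> Q3"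
  then obtain w1 w2 w3 where w: "ridge_end S P Q1 v w1" "ridge_end S P Q2 v w2" "ridge_end S P Q3 v w3"
    by blast
  note N = w[THEN ridge_end_nearest(2)]
  have nP: "Q1 \<noteq> P" "Q2 \<noteq> P" "Q3 \<noteq> P" using w by (auto simp: ridge_end_def)
  define a b c where abc: "a = cross2 (Q1 - P) (Q2 - P)" "b = cross2 (Q1 - P) (Q3 - P)"
    "c = cross2 (Q2 - P) (Q3 - P)"
  have skew: "cross2 (Q2 - P) (Q1 - P) = - a" "cross2 (Q3 - P) (Q1 - P) = - b"
    "cross2 (Q3 - P) (Q2 - P) = - c"
    by (simp_all add: abc cross2_def)
  have "0 < a * b" "0 < - a * c" "0 < - b * - c"
    using ridge_end_same_side[OF w(1) N(2) _ _ N(3)] ridge_end_same_side[OF w(2) N(1) _ _ N(3)]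
      ridge_end_same_side[OF w(3) N(1) _ _ N(2)] nP ne
    by (auto simp: skew simp flip: abc)
  then show False by (auto simp: zero_less_mult_iff mult_less_0_iff)
qed

text \<open>The bit \<open>up\<close> records on which side of the chord \<open>A B\<close> the site \<open>M\<close> lies, and thereby which of the
  directions \<open>rot a\<close> and \<open>- rot a\<close> is a positive combination of \<open>A - M\<close> and \<open>B - M\<close>.\<close>

definition between :: "(real^2) set \<Rightarrow> real^2 \<Rightarrow> bool \<Rightarrow> real^2 \<Rightarrow> real^2 \<Rightarrow> bool" where
  "between S a up M v \<longleftrightarrow> M \<in> nearest S v \<and>
     (\<exists>A \<in> nearest S v. \<exists>B \<in> nearest S v. A \<bullet> a < M \<bullet> a \<and> M \<bullet> a < B \<bullet> a \<and>
        (up \<longleftrightarrow> cross2 (A - M) (B - M) < 0))"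

text \<open>A positive combination of \<open>A - M\<close> and \<open>B - M\<close> can be chosen orthogonal to \<open>a\<close>, hence a multiple
  of \<open>rot a\<close>. Every direction into the cell of \<open>M\<close> has nonpositive inner product with both
  differences, so \<open>v\<close> is the unique extremal point of the cell in the direction \<open>rot a\<close> or
  \<open>- rot a\<close>.\<close>

lemma between_extremal:
  assumes "between S a up M v" "x \<in> voronoi_cell S M"
  shows "if up then (x - v) \<bullet> rot a \<le> 0 else (x - v) \<bullet> rot a \<ge> 0"
    and "(x - v) \<bullet> rot a = 0 \<Longrightarrow> x = v"
proof -
  obtain A B where AB: "M \<in> nearest S v" "A \<in> nearest S v" "B \<in> nearest S v"
    "A \<bullet> a < M \<bullet> a" "M \<bullet> a < B \<bullet> a" and up: "up \<longleftrightarrow> cross2 (A - M) (B - M) < 0"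
    using assms(1) by (auto simp: between_def)
  have ne: "A \<noteq> M" "B \<noteq> M" "A \<noteq> B" using AB by auto
  then have c: "cross2 (A - M) (B - M) \<noteq> 0"
    using AB(1-3) by (intro nearest_not_collinear[of _ S v]) auto
  have le: "(x - v) \<bullet> (R - M) \<le> 0" if "R \<in> nearest S v" for R
  proof -
    have "dist x M \<le> dist x R"
      using assms(2) that by (simp add: nearest_def voronoi_cell_def)
    then show ?thesis using dist_le_iff_from[OF nearest_dist_eq[OF AB(1) that]] by blast
  qed
  \<comment> \<open>the weights that make the combination orthogonal to \<open>a\<close>\<close>
  define \<alpha> \<beta> where "\<alpha> = (B - M) \<bullet> a" and "\<beta> = - ((A - M) \<bullet> a)"
  have pos: "0 < \<alpha>" "0 < \<beta>" using AB by (auto simp: \<alpha>_def \<beta>_def inner_diff)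
  have "\<alpha> *\<^sub>R (A - M) + \<beta> *\<^sub>R (B - M) = (- cross2 (A - M) (B - M)) *\<^sub>R rot a"
    by (simp add: vec2_eq_iff \<alpha>_def \<beta>_def inner_2 cross2_def algebra_simps)
  then have "(x - v) \<bullet> (\<alpha> *\<^sub>R (A - M) + \<beta> *\<^sub>R (B - M)) =
      (x - v) \<bullet> ((- cross2 (A - M) (B - M)) *\<^sub>R rot a)"
    by (rule arg_cong)
  then have eq: "\<alpha> * ((x - v) \<bullet> (A - M)) + \<beta> * ((x - v) \<bullet> (B - M)) =
      - (cross2 (A - M) (B - M) * ((x - v) \<bullet> rot a))"
    by (simp only: inner_add_right inner_scaleR_right mult_minus_left)
  have terms: "\<alpha> * ((x - v) \<bullet> (A - M)) \<le> 0" "\<beta> * ((x - v) \<bullet> (B - M)) \<le> 0"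
    using le AB pos by (simp_all add: mult_nonneg_nonpos)
  with eq have "0 \<le> cross2 (A - M) (B - M) * ((x - v) \<bullet> rot a)" by linarith
  with c up show "if up then (x - v) \<bullet> rot a \<le> 0 else (x - v) \<bullet> rot a \<ge> 0"
    by (auto simp: zero_le_mult_iff)
  show "x = v" if "(x - v) \<bullet> rot a = 0"
  proof -
    have "\<alpha> * ((x - v) \<bullet> (A - M)) = 0" "\<beta> * ((x - v) \<bullet> (B - M)) = 0"
      using terms eq unfolding that by linarith+
    then have "x - v = 0" using pos by (intro perp_both_0[OF c]) auto
    then show ?thesis by simp
  qed
qed

lemma between_unique:
  assumes "between S a up M v" "between S a up M v'"
  shows "v = v'"
proof -
  have "v \<in> voronoi_cell S M" "v' \<in> voronoi_cell S M"
    using assms by (auto simp: between_def nearest_def)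
  with between_extremal(1)[OF assms(1), of v'] between_extremal(1)[OF assms(2), of v]
  have "(v' - v) \<bullet> rot a = 0" by (auto simp: inner_diff split: if_splits)
  with between_extremal(2)[OF assms(1)] \<open>v' \<in> _\<close> show ?thesis by blast
qed

lemma ex_generic_direction:
  fixes S :: "(real^2) set"
  assumes "finite S"
  obtains a where "inj_on (\<lambda>x. x \<bullet> a) S"
proof -
  \<comment> \<open>each pair of sites excludes at most one slope\<close>
  let ?bad = "(\<lambda>(P, Q). - (P - Q) $ 1 / (P - Q) $ 2) ` (S \<times> S)"
  have "finite ?bad" using assms by simp
  then obtain t :: real where t: "t \<notin> ?bad"
    using ex_new_if_finite infinite_UNIV_char_0 by blast
  define a where "a = (vector [1, t] :: real^2)"
  have "inj_on (\<lambda>x. x \<bullet> a) S"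
  proof (rule inj_onI)
    fix P Q assume PQ: "P \<in> S" "Q \<in> S" "P \<bullet> a = Q \<bullet> a"
    then have eq: "(P - Q) $ 1 + t * (P - Q) $ 2 = 0"
      by (simp add: a_def inner_2 algebra_simps)
    have "t \<noteq> - (P - Q) $ 1 / (P - Q) $ 2" using t PQ by auto
    moreover have "t = - x / y" if "x + t * y = 0" "y \<noteq> 0" for x y :: real
    proof -
      have "x = - (t * y)" using that(1) by linarith
      then show ?thesis using that(2) by simp
    qed
    ultimately have "(P - Q) $ 2 = 0" using eq by blast
    with eq show "P = Q" by (simp add: vec2_eq_iff)
  qed
  with that show ?thesis by blast
qed

lemma ex_extremal:
  fixes N :: "'a::real_inner set"
  assumes "finite N" "N \<noteq> {}"
  obtains l where "l \<in> N" "\<And>R. R \<in> N \<Longrightarrow> l \<bullet> a \<le> R \<bullet> a"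
  using ex_min_if_finite[of "(\<lambda>x. x \<bullet> a) ` N"] assms by (force simp: not_less)

text \<open>A ridge between the first and the last nearest site cannot be charged to one of its sides. There is
  at most one such ridge at \<open>v\<close>.\<close>

definition ends_apart :: "(real^2) set \<Rightarrow> real^2 \<Rightarrow> real^2 \<Rightarrow> real^2 \<Rightarrow> real^2 \<Rightarrow> bool" where
  "ends_apart S a v l r \<longleftrightarrow> l \<in> nearest S v \<and> r \<in> nearest S v \<and>
     (\<forall>R \<in> nearest S v. l \<bullet> a \<le> R \<bullet> a \<and> R \<bullet> a \<le> r \<bullet> a)"

text \<open>If both sides of the ridge are extreme in direction \<open>a\<close> among the nearest sites, then a third
  nearest site lies strictly between them.\<close>

lemma ridge_end_charge:
  assumes fin: "finite S" and inj: "inj_on (\<lambda>x. x \<bullet> a) S" and e: "ridge_end S P Q v w"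
  obtains M up where "M \<in> S" "between S a up M v"
    "M = P \<or> M = Q \<or> ends_apart S a v P Q \<or> ends_apart S a v Q P"
proof -
  let ?N = "nearest S v"
  obtain R where R: "R \<in> ?N" "R \<noteq> P" "R \<noteq> Q" using ridge_end_third[OF fin e] by blast
  note PQ = ridge_end_nearest[OF e]
  have N: "finite ?N" "?N \<noteq> {}" "?N \<subseteq> S" using fin R by (auto simp: nearest_def)
  obtain l where l: "l \<in> ?N" "\<And>R. R \<in> ?N \<Longrightarrow> l \<bullet> a \<le> R \<bullet> a" using ex_extremal[OF N(1,2)] by metis
  obtain r where r: "r \<in> ?N" "\<And>R. R \<in> ?N \<Longrightarrow> r \<bullet> (- a) \<le> R \<bullet> (- a)"
    using ex_extremal[OF N(1,2)] by metis
  have mid: "\<exists>up. between S a up M v" if "M \<in> ?N" "M \<noteq> l" "M \<noteq> r" for M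
  proof -
    have "M \<in> S" "l \<in> S" "r \<in> S" using that(1) l(1) r(1) N(3) by blast+
    then have "l \<bullet> a \<noteq> M \<bullet> a" "r \<bullet> a \<noteq> M \<bullet> a"
      using inj_onD[OF inj, of M l] inj_onD[OF inj, of M r] that(2,3) by auto
    moreover have "l \<bullet> a \<le> M \<bullet> a" "M \<bullet> a \<le> r \<bullet> a" using l(2) r(2)[of M] that(1) by auto
    ultimately have "l \<bullet> a < M \<bullet> a" "M \<bullet> a < r \<bullet> a" by simp_all
    with that(1) l(1) r(1) show ?thesis unfolding between_def by blast
  qed
  have apart: "ends_apart S a v l r" using l r by (auto simp: ends_apart_def)
  have "P \<noteq> Q" using e by (simp add: ridge_end_def)
  consider "P \<noteq> l \<and> P \<noteq> r" | "Q \<noteq> l \<and> Q \<noteq> r" | "(P = l \<and> Q = r \<or> P = r \<and> Q = l)"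
    using \<open>P \<noteq> Q\<close> by blast
  then show ?thesis
  proof cases
    case 1 with mid[of P] PQ N(3) that[of P] show ?thesis by blast
  next
    case 2 with mid[of Q] PQ N(3) that[of Q] show ?thesis by blast
  next
    case 3 with mid[of R] R N(3) apart that[of R] show ?thesis by blast
  qed
qed

text \<open>For each site \<open>M\<close> and bit \<open>up\<close> only one end \<open>v\<close> is possible. There, at most \<open>2 + 2\<close> ordered pairs
  contain \<open>M\<close>, and at most two consist of the first and the last nearest site.\<close>

lemma card_ridge_ends:
  assumes fin: "finite S"
  shows "card {(P, Q). \<exists>v w. ridge_end S P Q v w} \<le> 12 * card S"
proof -
  obtain a where inj: "inj_on (\<lambda>x. x \<bullet> a) S" using ex_generic_direction[OF fin] by blast
  define G where "G = (\<lambda>(M, up). {(P, Q). \<exists>v. between S a up M v \<and> (\<exists>w. ridge_end S P Q v w) \<and>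
      (M = P \<or> M = Q \<or> ends_apart S a v P Q \<or> ends_apart S a v Q P)})"
  have six: "card (G x) \<le> 6" for x
  proof (cases "\<exists>v. between S a (snd x) (fst x) v")
    case False
    then have "G x = {}" by (auto simp: G_def split: prod.splits)
    then show ?thesis by simp
  next
    case True
    obtain M up where [simp]: "x = (M, up)" by force
    obtain v where v: "between S a up M v" using True by auto
    define H where "H = {Q. \<exists>w. ridge_end S M Q v w}"
    have H: "card H \<le> 2" by (simp add: H_def ridge_end_at_most_two)
    have finH: "finite H" using fin by (rule finite_subset[rotated]) (auto simp: H_def ridge_end_def)
    define K where "K = {(P, Q). ends_apart S a v P Q}"
    have K: "card K \<le> 1" "finite K"
    proof -
      have "x = y" if "x \<in> K" "y \<in> K" for x y
      proof -
        have eq: "P = P'" if "P \<in> nearest S v" "P' \<in> nearest S v" "P \<bullet> a \<le> P' \<bullet> a" "P' \<bullet> a \<le> P \<bullet> a" for P P'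
          using that inj by (auto simp: nearest_def inj_on_def)
        obtain P Q P' Q' where [simp]: "x = (P, Q)" "y = (P', Q')" by (metis prod.exhaust)
        have "ends_apart S a v P Q" "ends_apart S a v P' Q'" using that by (auto simp: K_def)
        then have "P = P'" "Q = Q'" unfolding ends_apart_def by (auto intro!: eq)
        then show ?thesis by simp
      qed
      then have "K = {} \<or> (\<exists>x. K = {x})" by blast
      then show "card K \<le> 1" "finite K" by auto
    qed
    have "G x \<subseteq> ({M} \<times> H \<union> H \<times> {M}) \<union> (K \<union> prod.swap ` K)"
    proof
      fix y assume "y \<in> G x"
      then obtain P Q v' w where y: "y = (P, Q)" "between S a up M v'" "ridge_end S P Q v' w"
        "M = P \<or> M = Q \<or> ends_apart S a v' P Q \<or> ends_apart S a v' Q P"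
        by (auto simp: G_def)
      moreover have "v' = v" using between_unique[OF v y(2)] by simp
      moreover have "ridge_end S Q P v' w" using y(3) ridge_end_sym by blast
      ultimately show "y \<in> ({M} \<times> H \<union> H \<times> {M}) \<union> (K \<union> prod.swap ` K)"
        unfolding H_def K_def by auto
    qed
    then have "card (G x) \<le> card (({M} \<times> H \<union> H \<times> {M}) \<union> (K \<union> prod.swap ` K))"
      using finH K by (intro card_mono) auto
    also have "\<dots> \<le> (card ({M} \<times> H) + card (H \<times> {M})) + (card K + card (prod.swap ` K))"
      by (meson card_Un_le order_trans add_mono)
    also have "\<dots> \<le> (2 + 2) + (1 + 1)"
      using H K card_image_le[OF K(2), of prod.swap] by (intro add_mono) (auto simp: card_cartesian_product)
    finally show ?thesis by simp
  qed
  have "{(P, Q). \<exists>v w. ridge_end S P Q v w} \<subseteq> (\<Union>x\<in>S \<times> UNIV. G x)"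
  proof clarify
    fix P Q v w assume e: "ridge_end S P Q v w"
    obtain M up where "M \<in> S" "between S a up M v"
      "M = P \<or> M = Q \<or> ends_apart S a v P Q \<or> ends_apart S a v Q P"
      using ridge_end_charge[OF fin inj e] by blast
    with e have "(P, Q) \<in> G (M, up)" "(M, up) \<in> S \<times> UNIV" by (auto simp: G_def)
    then show "(P, Q) \<in> (\<Union>x\<in>S \<times> UNIV. G x)" by blast
  qed
  moreover have "finite (\<Union>x\<in>S \<times> UNIV. G x)"
  proof (rule finite_subset)
    show "(\<Union>x\<in>S \<times> UNIV. G x) \<subseteq> S \<times> S" by (auto simp: G_def ridge_end_def)
  qed (use fin in simp)
  ultimately have "card {(P, Q). \<exists>v w. ridge_end S P Q v w} \<le> card (\<Union>x\<in>S \<times> UNIV. G x)"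
    by (rule card_mono[rotated])
  also have "\<dots> \<le> (\<Sum>x\<in>S \<times> (UNIV :: bool set). card (G x))" using fin by (intro card_UN_le) auto
  also have "\<dots> \<le> (\<Sum>x\<in>S \<times> (UNIV :: bool set). 6)" by (intro sum_mono six)
  also have "\<dots> = 12 * card S" by (simp add: card_cartesian_product)
  finally show ?thesis .
qed

section \<open>Reflections in complex coordinates\<close>

definition cpx :: "real^2 \<Rightarrow> complex" where
  "cpx x = Complex (x $ 1) (x $ 2)"

lemma cpx_simps [simp]: "Re (cpx x) = x $ 1" "Im (cpx x) = x $ 2"
  "cpx (x - y) = cpx x - cpx y" "cpx (c *\<^sub>R x) = of_real c * cpx x" "cpx x = cpx y \<longleftrightarrow> x = y"
  by (auto simp: cpx_def complex_eq_iff vec2_eq_iff)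

text \<open>The hypotheses say that \<open>a\<close> and \<open>a + d\<close> are equidistant from \<open>P\<close> and \<open>Q\<close>; the conclusion is the
  formula for the reflection in the line through \<open>a\<close> with direction \<open>d\<close>.\<close>

lemma reflect_in_bisector:
  fixes P Q a d :: complex
  assumes "d \<noteq> 0" "P \<noteq> Q" "(P - a) * cnj (P - a) = (Q - a) * cnj (Q - a)"
    "(P - Q) * cnj d + cnj (P - Q) * d = 0"
  shows "Q = (a - d / cnj d * cnj a) + d / cnj d * cnj P"
proof -
  define x y where "x = P - a" and "y = Q - a"
  have "x \<noteq> y" "x * cnj x = y * cnj y" "(x - y) * cnj d = - ((cnj x - cnj y) * d)"
    using assms(2-4) by (auto simp: x_def y_def eq_neg_iff_add_eq_0)
  moreover have "(x - y) * (y * cnj d) = (x - y) * (cnj x * d)"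
  proof -
    have "(x - y) * (y * cnj d) = y * ((x - y) * cnj d)" by (simp add: algebra_simps)
    also have "\<dots> = - (y * cnj x - y * cnj y) * d" 
      unfolding \<open>(x - y) * cnj d = _\<close> by (simp add: algebra_simps)
    also have "\<dots> = (x - y) * (cnj x * d)"
      unfolding \<open>x * cnj x = y * cnj y\<close>[symmetric] by (simp add: algebra_simps)
    finally show ?thesis .
  qed
  ultimately have "y * cnj d = cnj x * d" by simp
  then have "y = d / cnj d * cnj x" using \<open>d \<noteq> 0\<close> by (simp add: field_simps)
  then show ?thesis by (simp add: x_def y_def algebra_simps)
qed

lemma cpx_inner: "cpx x * cnj (cpx y) + cnj (cpx x) * cpx y = 2 * of_real (x \<bullet> y)"
  by (simp add: complex_eq_iff inner_2)

text \<open>For \<open>cmod U = 1\<close> the map \<open>z \<mapsto> U * cnj z\<close> is a reflection in a line through the origin, and both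
  points lie on that line.\<close>

lemma fixed_lines_collinear:
  fixes x y U :: complex
  assumes "x = U * cnj x" "y = U * cnj y" "x \<noteq> 0"
  shows "Im (y * cnj x) = 0"
proof -
  have "cmod x = cmod U * cmod x" by (metis assms(1) complex_mod_cnj norm_mult)
  with assms(3) have "U * cnj U = 1" by (simp add: complex_norm_square[symmetric])
  have "y * cnj x = U * cnj y * cnj (U * cnj x)" using assms(1,2) by metis
  also have "\<dots> = (U * cnj U) * (cnj y * x)" by simp
  finally have "y * cnj x = cnj (y * cnj x)" using \<open>U * cnj U = 1\<close> by simp
  then have "Im (y * cnj x) = - Im (y * cnj x)" by (metis cnj.sel(2))
  then show ?thesis by simp
qed

section \<open>The combinatorial structure of a tessellation\<close>

text \<open>In both cases \<open>geom_vec1 g + ridge_dir g\<close> is another point of the ridge, so that segments and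
  rays are treated alike.\<close>

fun ridge_dir :: "ridge_geom \<Rightarrow> real^2" where
  "ridge_dir (Segment a b) = b - a"
| "ridge_dir (Ray a d) = d"

lemma closed_segment_sub_mem:
  fixes a w :: "'a::real_vector"
  assumes "w \<noteq> 0" "t > 0"
  shows "a - t *\<^sub>R w \<notin> closed_segment a (a + w)"
proof
  assume "a - t *\<^sub>R w \<in> closed_segment a (a + w)"
  then obtain u where u: "0 \<le> u" "a - t *\<^sub>R w = a + u *\<^sub>R w"
    by (auto simp: in_segment algebra_simps)
  then have "(u + t) *\<^sub>R w = 0" by (simp add: algebra_simps)
  with assms u(1) show False by simp
qed

lemma ray_sub_mem:
  fixes a w :: "'a::real_vector"
  assumes "w \<noteq> 0" "t > 0"
  shows "a - t *\<^sub>R w \<notin> {a + u *\<^sub>R w |u. 0 \<le> u}"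
proof
  assume "a - t *\<^sub>R w \<in> {a + u *\<^sub>R w |u. 0 \<le> u}"
  then obtain u where u: "0 \<le> u" "a - t *\<^sub>R w = a + u *\<^sub>R w" by auto
  then have "(u + t) *\<^sub>R w = 0" by (simp add: algebra_simps)
  with assms u(1) show False by simp
qed

locale voronoi_description =
  fixes T :: tessellation and S :: "(real^2) set" and p :: "nat \<Rightarrow> real^2"
  assumes fin: "finite S" and desc: "describes_voronoi T S p"
begin

abbreviation "n \<equiv> length (cells T)"
abbreviation "E \<equiv> length (ridges T)"
abbreviation "s1 k \<equiv> side1 (ridges T ! k)"
abbreviation "s2 k \<equiv> side2 (ridges T ! k)"
abbreviation "gm k \<equiv> geom (ridges T ! k)"

lemma p_bij: "bij_betw p {..<n} S"
  using desc by (simp add: describes_voronoi_def)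

lemma card_S: "card S = n"
  using bij_betw_same_card[OF p_bij] by simp

lemma p_in_S: "i < n \<Longrightarrow> p i \<in> S"
  using p_bij by (auto simp: bij_betw_def)

lemma p_inj: "i < n \<Longrightarrow> j < n \<Longrightarrow> p i = p j \<longleftrightarrow> i = j"
  using p_bij by (auto simp: bij_betw_def inj_on_def)

lemma ridge:
  assumes "k < E"
  shows "s1 k < n" "s2 k < n" "adjacent S (p (s1 k)) (p (s2 k))"
    "ridge_points (gm k) = shared_boundary S (p (s1 k)) (p (s2 k))"
proof -
  have "\<forall>r \<in> set (ridges T). side1 r < n \<and> side2 r < n \<and> adjacent S (p (side1 r)) (p (side2 r)) \<and>
      ridge_points (geom r) = shared_boundary S (p (side1 r)) (p (side2 r))"
    using desc by (simp add: describes_voronoi_def)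
  from bspec[OF this nth_mem[OF assms]]
  show "s1 k < n" "s2 k < n" "adjacent S (p (s1 k)) (p (s2 k))"
    "ridge_points (gm k) = shared_boundary S (p (s1 k)) (p (s2 k))"
    by simp_all
qed

lemma sides_ne: "k < E \<Longrightarrow> s1 k \<noteq> s2 k"
  using ridge(3)[of k] by (auto simp: adjacent_def)

lemma ridge_unique:
  assumes "k < E" "m < E" "{s1 k, s2 k} = {s1 m, s2 m}"
  shows "k = m"
proof -
  have "\<exists>!l. l < E \<and> {s1 l, s2 l} = {s1 m, s2 m}"
    using desc ridge[OF assms(2)] unfolding describes_voronoi_def by simp
  with assms show ?thesis by blast
qed

lemma ridge_exists:
  assumes "i < n" "j < n" "adjacent S (p i) (p j)"
  obtains k where "k < E" "{s1 k, s2 k} = {i, j}"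
  using desc assms unfolding describes_voronoi_def by blast

lemma cell_ridges:
  assumes "c < n"
  shows "distinct (cells T ! c)" "set (cells T ! c) = {k. k < E \<and> c \<in> {s1 k, s2 k}}"
    "cyclic_order (ridges T) (cells T ! c)"
  using desc assms unfolding describes_voronoi_def by simp_all

lemma ridge_nontrivial:
  assumes "k < E"
  shows "ridge_dir (gm k) \<noteq> 0"
proof
  assume "ridge_dir (gm k) = 0"
  then have "ridge_points (gm k) \<subseteq> {geom_vec1 (gm k)}" by (cases "gm k") auto
  moreover obtain x y where "x \<noteq> y" "closed_segment x y \<subseteq> ridge_points (gm k)"
    using ridge[OF assms] by (auto simp: adjacent_def)
  ultimately have "x \<in> {geom_vec1 (gm k)}" "y \<in> {geom_vec1 (gm k)}"
    using ends_in_segment[of x y] by blast+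
  with \<open>x \<noteq> y\<close> show False by simp
qed

lemma ridge_end_base:
  assumes "k < E"
  shows "ridge_end S (p (s1 k)) (p (s2 k)) (geom_vec1 (gm k)) (ridge_dir (gm k))"
proof -
  have "geom_vec1 (gm k) \<in> ridge_points (gm k) \<and>
      geom_vec1 (gm k) + ridge_dir (gm k) \<in> ridge_points (gm k) \<and>
      (\<forall>t>0. geom_vec1 (gm k) - t *\<^sub>R ridge_dir (gm k) \<notin> ridge_points (gm k))"
  proof (cases "gm k")
    case (Segment a b)
    then show ?thesis using ridge_nontrivial[OF assms] closed_segment_sub_mem[of "b - a" _ a] by auto
  next
    case (Ray a d)
    have "a \<in> ridge_points (gm k)" "a + d \<in> ridge_points (gm k)"
      unfolding Ray ridge_points.simps by (force intro: exI[of _ 0], force intro: exI[of _ 1])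
    then show ?thesis using Ray ridge_nontrivial[OF assms] ray_sub_mem[of d _ a] by auto
  qed
  then show ?thesis
    using ridge[OF assms] ridge_nontrivial[OF assms] by (auto simp: ridge_end_def adjacent_def)
qed

lemma ridge_end_tip:
  assumes "k < E" "gm k = Segment a b"
  shows "ridge_end S (p (s1 k)) (p (s2 k)) b (a - b)"
  using ridge[OF assms(1)] ridge_nontrivial[OF assms(1)] closed_segment_sub_mem[of "a - b" _ b] assms(2)
  by (auto simp: ridge_end_def adjacent_def closed_segment_commute)

lemma ridge_bound: "E \<le> 12 * card S"
proof -
  have "inj_on (\<lambda>k. (p (s1 k), p (s2 k))) {..<E}"
    by (rule inj_onI) (auto simp: p_inj ridge intro: ridge_unique)
  then have "E = card ((\<lambda>k. (p (s1 k), p (s2 k))) ` {..<E})" by (simp add: card_image)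
  also have "\<dots> \<le> card {(P, Q). \<exists>v w. ridge_end S P Q v w}"
  proof (rule card_mono)
    show "finite {(P, Q). \<exists>v w. ridge_end S P Q v w}"
      by (rule finite_subset[of _ "S \<times> S"]) (auto simp: ridge_end_def fin)
    show "(\<lambda>k. (p (s1 k), p (s2 k))) ` {..<E} \<subseteq> {(P, Q). \<exists>v w. ridge_end S P Q v w}"
      using ridge_end_base by auto
  qed
  also have "\<dots> \<le> 12 * card S" by (rule card_ridge_ends[OF fin])
  finally show ?thesis .
qed

text \<open>Positions \<open>t\<close> in the concatenated ridge lists play the role of half-edges: \<open>in_cell c t\<close> says that
  position \<open>t\<close> belongs to the list of cell \<open>c\<close>, and \<open>next_pos c t\<close>, \<open>prev_pos c t\<close> are its cyclic
  neighbours in that list.\<close>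

definition "start i = length (concat (take i (cells T)))"
definition "ridge_at t = concat (cells T) ! t"

lemma start_0 [simp]: "start 0 = 0"
  by (simp add: start_def)

lemma start_Suc: "i < n \<Longrightarrow> start (Suc i) = start i + length (cells T ! i)"
  by (simp add: start_def take_Suc_conv_app_nth)

lemma start_n: "start n = length (concat (cells T))"
  by (simp add: start_def)

lemma start_mono: "i \<le> j \<Longrightarrow> start i \<le> start j"
proof -
  assume "i \<le> j"
  then obtain zs where "take j (cells T) = take i (cells T) @ zs"
    by (metis le_add_diff_inverse take_add)
  then show ?thesis by (simp add: start_def)
qed

lemma ridge_at_nth:
  assumes "c < n" "start c \<le> t" "t < start (Suc c)"
  shows "ridge_at t = cells T ! c ! (t - start c)"
proof -
  have "concat (cells T) = concat (take c (cells T)) @ cells T ! c @ concat (drop (Suc c) (cells T))"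
    using id_take_nth_drop[OF assms(1)] by (metis concat.simps(2) concat_append)
  then show ?thesis using assms unfolding ridge_at_def
    by (simp add: nth_append start_def take_Suc_conv_app_nth less_diff_conv2)
qed

definition "in_cell c t \<longleftrightarrow> c < n \<and> start c \<le> t \<and> t < start (Suc c)"

lemma ridge_at_in_cell: "in_cell c t \<Longrightarrow> ridge_at t < E \<and> c \<in> {s1 (ridge_at t), s2 (ridge_at t)}"
proof -
  assume t: "in_cell c t"
  then have "ridge_at t \<in> set (cells T ! c)"
    unfolding in_cell_def by (auto simp: ridge_at_nth start_Suc)
  with t cell_ridges(2)[of c] show ?thesis by (auto simp: in_cell_def)
qed

lemma ex_in_cell:
  assumes "k < E" "c \<in> {s1 k, s2 k}"
  obtains t where "in_cell c t" "ridge_at t = k"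
proof -
  have c: "c < n" using assms ridge by auto
  then have "k \<in> set (cells T ! c)" using assms cell_ridges(2) by blast
  then obtain j where "j < length (cells T ! c)" "cells T ! c ! j = k" by (auto simp: in_set_conv_nth)
  with c that[of "start c + j"] show ?thesis by (auto simp: in_cell_def ridge_at_nth start_Suc)
qed

lemma ridge_at_inj: "in_cell c t \<Longrightarrow> in_cell c u \<Longrightarrow> ridge_at t = ridge_at u \<Longrightarrow> t = u"
  using cell_ridges(1)[of c] unfolding in_cell_def
  by (auto simp: ridge_at_nth start_Suc nth_eq_iff_index_eq)

text \<open>Double counting: every ridge is listed by its two sides only.\<close>

lemma half_ridges_bound: "start n \<le> 2 * E"
proof -
  have "start n = (\<Sum>c<n. length (cells T ! c))"
    by (simp add: start_n length_concat sum_list_sum_nth atLeast0LessThan)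
  also have "\<dots> = (\<Sum>c<n. card ({..<E} \<inter> {k. c \<in> {s1 k, s2 k}}))"
    by (intro sum.cong refl) (simp add: distinct_card[symmetric] cell_ridges Int_def)
  also have "\<dots> = (\<Sum>c<n. \<Sum>k<E. if c \<in> {s1 k, s2 k} then 1 else 0)"
    by (intro sum.cong refl) (simp only: sum.If_cases finite_lessThan, simp)
  also have "\<dots> = (\<Sum>k<E. \<Sum>c<n. if c \<in> {s1 k, s2 k} then 1 else 0)" by (rule sum.swap)
  also have "\<dots> = (\<Sum>k<E. card ({..<n} \<inter> {c. c \<in> {s1 k, s2 k}}))"
    by (intro sum.cong refl) (simp only: sum.If_cases finite_lessThan, simp)
  also have "\<dots> \<le> (\<Sum>k<E. 2)"
  proof (rule sum_mono)
    fix k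
    have "card ({..<n} \<inter> {c. c \<in> {s1 k, s2 k}}) \<le> card {s1 k, s2 k}" by (intro card_mono) auto
    also have "\<dots> \<le> 2" by (simp add: card_insert_if)
    finally show "card ({..<n} \<inter> {c. c \<in> {s1 k, s2 k}}) \<le> 2" .
  qed
  finally show ?thesis by simp
qed

definition "other c k = (if s1 k = c then s2 k else s1 k)"

lemma other: "k < E \<Longrightarrow> c \<in> {s1 k, s2 k} \<Longrightarrow> {s1 k, s2 k} = {c, other c k} \<and> other c k \<noteq> c \<and> other c k < n"
  using ridge[of k] sides_ne[of k] by (auto simp: other_def)

lemma other_inj:
  assumes "k < E" "c \<in> {s1 k, s2 k}" "m < E" "c \<in> {s1 m, s2 m}" "other c k = other c m"
  shows "k = m"
  using other[OF assms(1,2)] other[OF assms(3,4)] assms by (intro ridge_unique) auto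

definition "next_pos c t = (if Suc t = start (Suc c) then start c else Suc t)"
definition "prev_pos c t = (if t = start c then start (Suc c) - 1 else t - 1)"

lemma in_cell_next: "in_cell c t \<Longrightarrow> in_cell c (next_pos c t)"
  by (auto simp: in_cell_def next_pos_def)

lemma in_cell_prev: "in_cell c t \<Longrightarrow> in_cell c (prev_pos c t)"
  by (auto simp: in_cell_def prev_pos_def)

lemma next_prev_pos: "in_cell c t \<Longrightarrow> next_pos c (prev_pos c t) = t"
  by (auto simp: in_cell_def prev_pos_def next_pos_def)

definition "touching k m \<longleftrightarrow> ridge_ends (gm k) \<inter> ridge_ends (gm m) \<noteq> {}"

lemma touching_next:
  assumes "in_cell c t"
  shows "touching (ridge_at t) (ridge_at (next_pos c t))"
proof -
  define j where "j = t - start c"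
  have c: "c < n" "start c \<le> t" "t < start (Suc c)" using assms by (auto simp: in_cell_def)
  then have j: "j < length (cells T ! c)" by (simp add: j_def start_Suc)
  have "next_pos c t - start c = Suc j mod length (cells T ! c)"
  proof (cases "Suc j = length (cells T ! c)")
    case True
    then have "Suc t = start (Suc c)" using c by (simp add: j_def start_Suc)
    then show ?thesis using True by (simp add: next_pos_def)
  next
    case False
    then have "Suc t \<noteq> start (Suc c)" using c by (simp add: j_def start_Suc)
    then show ?thesis using False j c by (simp add: next_pos_def j_def Suc_diff_le)
  qed
  moreover have "ridge_at (next_pos c t) = cells T ! c ! (next_pos c t - start c)" "ridge_at t = cells T ! c ! j"
    using in_cell_next[OF assms] c by (auto simp: in_cell_def ridge_at_nth j_def)
  moreover have "ridge_ends (gm (cells T ! c ! j)) \<inter>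
      ridge_ends (gm (cells T ! c ! (Suc j mod length (cells T ! c)))) \<noteq> {}"
    using cell_ridges(3)[OF c(1)] j unfolding cyclic_order_def by blast
  ultimately show ?thesis by (simp add: touching_def)
qed

lemma touching_prev:
  assumes "in_cell c t"
  shows "touching (ridge_at t) (ridge_at (prev_pos c t))"
  using touching_next[OF in_cell_prev[OF assms]] next_prev_pos[OF assms]
  by (auto simp: touching_def)

lemma neighbours_distinct:
  assumes "in_cell c t" "3 \<le> length (cells T ! c)"
  shows "next_pos c t \<noteq> t" "prev_pos c t \<noteq> t" "next_pos c t \<noteq> prev_pos c t"
  using assms by (auto simp: in_cell_def next_pos_def prev_pos_def start_Suc)

end

section \<open>Closed chains of three reflections\<close>

lemma cpx_eq_0 [simp]: "cpx x = 0 \<longleftrightarrow> x = 0"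
  by (simp add: cpx_def complex_eq_iff vec2_eq_iff)

lemma bounded_ray_imp_0:
  fixes a d :: "'a::real_normed_vector"
  shows "bounded {a + t *\<^sub>R d |t. 0 \<le> t} \<Longrightarrow> d = 0"
proof (rule ccontr)
  assume "bounded {a + t *\<^sub>R d |t. 0 \<le> t}" "d \<noteq> 0"
  then obtain B where B: "\<And>t. 0 \<le> t \<Longrightarrow> norm (a + t *\<^sub>R d) \<le> B" by (auto simp: bounded_iff)
  define t where "t = (\<bar>B\<bar> + norm a + 1) / norm d"
  have "0 \<le> t" "t * norm d = \<bar>B\<bar> + norm a + 1" using \<open>d \<noteq> 0\<close> by (simp_all add: t_def)
  moreover have "norm (t *\<^sub>R d) \<le> norm (a + t *\<^sub>R d) + norm a"
    using norm_triangle_ineq4[of "a + t *\<^sub>R d" a] by simp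
  ultimately show False using B[of t] by simp
qed

lemma ridge_ends_in_points: "Some x \<in> ridge_ends g \<Longrightarrow> x \<in> ridge_points g"
  by (cases g) (auto intro: exI[of _ 0])

text \<open>A third nearest site makes \<open>v\<close> a vertex of both cells, and nondegeneracy of either of them
  bounds the number of sites there.\<close>

lemma nondegenerate_ridge_end:
  assumes "finite S" "ridge_end S P Q v w" "nondegenerate_cell S P \<or> nondegenerate_cell S Q"
  obtains R where "R \<noteq> P" "R \<noteq> Q" "nearest S v = {P, Q, R}"
proof -
  obtain R where R: "R \<in> nearest S v" "R \<noteq> P" "R \<noteq> Q" using ridge_end_third[OF assms(1,2)] by blast
  note N = ridge_end_nearest[OF assms(2)]
  have "P \<noteq> Q" using assms(2) by (simp add: ridge_end_def)
  have "v extreme_point_of voronoi_cell S P"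
    by (rule three_nearest_extreme[OF N R(1)]) (use R \<open>P \<noteq> Q\<close> in auto)
  moreover have "v extreme_point_of voronoi_cell S Q"
    by (rule three_nearest_extreme[OF N(2,1) R(1)]) (use R \<open>P \<noteq> Q\<close> in auto)
  ultimately have "card (nearest S v) = 3"
    using assms(3) unfolding nondegenerate_cell_def nearest_def by blast
  moreover have "card {P, Q, R} = 3" using R \<open>P \<noteq> Q\<close> by auto
  moreover have "finite (nearest S v)" using assms(1) by (simp add: nearest_def)
  ultimately have "{P, Q, R} = nearest S v"
    using N R(1) by (intro card_subset_eq) auto
  with that R show ?thesis by metis
qed

context voronoi_description
begin

definition "mirror_u k = cpx (ridge_dir (gm k)) / cnj (cpx (ridge_dir (gm k)))"
definition "mirror_o k = cpx (geom_vec1 (gm k)) - mirror_u k * cnj (cpx (geom_vec1 (gm k)))"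
definition "mirror k z = mirror_o k + mirror_u k * cnj z"

lemma dist_sq_cpx: "of_real ((dist x y)\<^sup>2) = (cpx x - cpx y) * cnj (cpx x - cpx y)"
  by (simp add: complex_eq_iff dist_norm power2_norm_eq_inner inner_2 algebra_simps)

lemma mirror_swaps:
  assumes "k < E"
  shows "cpx (p (s2 k)) = mirror k (cpx (p (s1 k)))"
proof -
  let ?a = "geom_vec1 (gm k)" and ?d = "ridge_dir (gm k)" and ?P = "p (s1 k)" and ?Q = "p (s2 k)"
  have e: "ridge_end S ?P ?Q ?a ?d" by (rule ridge_end_base[OF assms])
  have "cpx ?Q = (cpx ?a - cpx ?d / cnj (cpx ?d) * cnj (cpx ?a)) + cpx ?d / cnj (cpx ?d) * cnj (cpx ?P)"
  proof (rule reflect_in_bisector)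
    show "cpx ?d \<noteq> 0" using ridge_nontrivial[OF assms] by simp
    show "cpx ?P \<noteq> cpx ?Q" using e by (simp add: ridge_end_def)
    have "dist ?P ?a = dist ?Q ?a"
      using nearest_dist_eq[OF ridge_end_nearest[OF e]] by (simp add: dist_commute)
    then show "(cpx ?P - cpx ?a) * cnj (cpx ?P - cpx ?a) = (cpx ?Q - cpx ?a) * cnj (cpx ?Q - cpx ?a)"
      by (simp only: dist_sq_cpx[symmetric])
    have "?d \<bullet> (?P - ?Q) = 0"
      using ridge_end_perp[OF e] by (simp add: inner_diff_right)
    then show "(cpx ?P - cpx ?Q) * cnj (cpx ?d) + cnj (cpx ?P - cpx ?Q) * cpx ?d = 0"
      using cpx_inner[of "?P - ?Q" ?d] by (simp add: inner_commute)
  qed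
  then show ?thesis by (simp add: mirror_def mirror_o_def mirror_u_def)
qed

lemma mirror_involution:
  assumes "k < E"
  shows "mirror k (mirror k z) = z"
proof -
  have "cpx (ridge_dir (gm k)) \<noteq> 0"
    using ridge_nontrivial[OF assms] by simp
  then have "mirror_u k * cnj (mirror_u k) = 1" by (simp add: mirror_u_def)
  moreover have "mirror k (mirror k z) = cpx (geom_vec1 (gm k))
      - (mirror_u k * cnj (mirror_u k)) * cpx (geom_vec1 (gm k)) + (mirror_u k * cnj (mirror_u k)) * z"
    by (simp add: mirror_def mirror_o_def algebra_simps)
  ultimately show ?thesis by simp
qed

lemma mirror_other:
  assumes "k < E" "c \<in> {s1 k, s2 k}"
  shows "cpx (p (other c k)) = mirror k (cpx (p c))"
  using assms mirror_swaps mirror_involution[OF assms(1)] sides_ne[OF assms(1)]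
  by (auto simp: other_def)

lemma mirror_fixes_bisector:
  assumes "k < E" "dist x (p (s1 k)) = dist x (p (s2 k))"
  shows "mirror k (cpx x) = cpx x"
proof -
  let ?a = "geom_vec1 (gm k)" and ?d = "ridge_dir (gm k)" and ?P = "p (s1 k)" and ?Q = "p (s2 k)"
  have e: "ridge_end S ?P ?Q ?a ?d" by (rule ridge_end_base[OF assms(1)])
  have "dist ?a ?P = dist ?a ?Q" by (rule nearest_dist_eq[OF ridge_end_nearest[OF e]])
  then have "(x - ?a) \<bullet> (?Q - ?P) = 0"
    using assms(2) by (simp add: dist_eq_iff inner_diff_left)
  moreover have "?d \<bullet> (?Q - ?P) = 0" "?Q - ?P \<noteq> 0"
    using ridge_end_perp[OF e] e by (auto simp: ridge_end_def)
  ultimately have "cross2 ?d (x - ?a) = 0"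
    using parallel_if_perp[of "?Q - ?P" ?d "x - ?a"] by (simp add: inner_commute)
  then obtain c where "x - ?a = c *\<^sub>R ?d"
    using cross2_eq_0_scale ridge_nontrivial[OF assms(1)] by metis
  then have "x = ?a + c *\<^sub>R ?d" by (simp add: algebra_simps)
  then have x: "cpx x = cpx ?a + of_real c * cpx ?d" by (simp add: cpx_def complex_eq_iff)
  have "cpx ?d \<noteq> 0" using ridge_nontrivial[OF assms(1)] by simp
  then have "mirror_u k * cnj (cpx ?d) = cpx ?d" by (simp add: mirror_u_def)
  then show ?thesis unfolding x by (simp add: mirror_def mirror_o_def algebra_simps)
qed

text \<open>The composite of the reflections in the ridges \<open>k\<close>, \<open>m\<close>, \<open>l\<close>, in this order, is
  \<open>z \<mapsto> turn_o k m l + turn_u k m l * cnj z\<close>.\<close>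

definition "turn_u k m l = mirror_u l * cnj (mirror_u m) * mirror_u k"
definition "turn_o k m l = mirror_o l + mirror_u l * cnj (mirror_o m) + mirror_u l * cnj (mirror_u m) * mirror_o k"

lemma turn: "mirror l (mirror m (mirror k z)) = turn_o k m l + turn_u k m l * cnj z"
  by (simp add: mirror_def turn_o_def turn_u_def algebra_simps)

text \<open>One ridge for each of the three pairs among the cells \<open>s1 k\<close>, \<open>s2 k\<close>, \<open>r\<close>: the reflections in \<open>k\<close>,
  \<open>m\<close>, \<open>l\<close> form a closed chain from the first cell back to itself.\<close>

definition "triad k m l r \<longleftrightarrow> k < E \<and> m < E \<and> l < E \<and>
  {s1 m, s2 m} = {s2 k, r} \<and> {s1 l, s2 l} = {r, s1 k}"

lemma triad_generator:
  assumes "triad k m l r"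
  shows "cpx (p (s1 k)) = turn_o k m l + turn_u k m l * cnj (cpx (p (s1 k)))"
proof -
  have t: "k < E" "m < E" "l < E" "{s1 m, s2 m} = {s2 k, r}" "{s1 l, s2 l} = {r, s1 k}"
    using assms by (auto simp: triad_def)
  have "other (s2 k) m = r" "other r l = s1 k"
    using t(4,5) sides_ne[OF t(2)] sides_ne[OF t(3)] by (auto simp: other_def doubleton_eq_iff)
  then have "mirror l (mirror m (mirror k (cpx (p (s1 k))))) = cpx (p (s1 k))"
    using mirror_other[of m "s2 k"] mirror_other[of l r] mirror_swaps[of k] t by auto
  then show ?thesis by (simp add: turn)
qed

lemma triad_centre:
  assumes "triad k m l r" "nearest S v = {p (s1 k), p (s2 k), p r}"
  shows "cpx v = turn_o k m l + turn_u k m l * cnj (cpx v)"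
proof -
  have t: "k < E" "m < E" "l < E" "{s1 m, s2 m} = {s2 k, r}" "{s1 l, s2 l} = {r, s1 k}"
    using assms by (auto simp: triad_def)
  have eq: "dist v (p x) = dist v (p y)" if "x \<in> {s1 k, s2 k, r}" "y \<in> {s1 k, s2 k, r}" for x y
  proof (rule nearest_dist_eq)
    show "p x \<in> nearest S v" "p y \<in> nearest S v" using that by (auto simp: assms(2))
  qed
  have "s1 m \<in> {s1 k, s2 k, r}" "s2 m \<in> {s1 k, s2 k, r}" "s1 l \<in> {s1 k, s2 k, r}" "s2 l \<in> {s1 k, s2 k, r}"
    using t(4,5) by blast+
  then have "mirror k (cpx v) = cpx v" "mirror m (cpx v) = cpx v" "mirror l (cpx v) = cpx v"
    by (auto intro!: mirror_fixes_bisector[OF t(1)] mirror_fixes_bisector[OF t(2)]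
      mirror_fixes_bisector[OF t(3)] eq)
  then have "mirror l (mirror m (mirror k (cpx v))) = cpx v" by simp
  then show ?thesis by (simp add: turn)
qed

lemma solve_generator:
  assumes "z = a + u * cnj z" "z = b + w * cnj z" "u \<noteq> w"
  shows "z = cnj ((b - a) / (u - w))"
proof -
  have "u * cnj z = z - a" "w * cnj z = z - b"
    using assms(1,2) by (metis add_diff_cancel_left')+
  then have "(u - w) * cnj z = b - a" by (simp add: left_diff_distrib)
  then have "cnj z = (b - a) / (u - w)" using assms(3) by (simp add: field_simps)
  then show ?thesis by (metis complex_cnj_cnj)
qed

text \<open>With \<open>P\<close> and \<open>v\<close>, the first chain fixes the line through both, and the second one fixes the line
  through \<open>P\<close> and \<open>v'\<close>. If the linear parts agree, the two lines are parallel, hence equal, and \<open>P\<close> lies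
  on the line through \<open>v\<close> and \<open>v'\<close>. That line is the bisector of \<open>P\<close> and its neighbour.\<close>

lemma turns_differ:
  assumes "triad k m l r" "nearest S v = {p (s1 k), p (s2 k), p r}"
    and "triad k m' l' r'" "nearest S v' = {p (s1 k), p (s2 k), p r'}"
    and "v \<noteq> v'"
  shows "turn_u k m l \<noteq> turn_u k m' l'"
proof
  assume eq: "turn_u k m l = turn_u k m' l'"
  let ?P = "p (s1 k)" and ?Q = "p (s2 k)" and ?u = "turn_u k m l"
  have near: "?P \<in> nearest S v" "?Q \<in> nearest S v" "?P \<in> nearest S v'" "?Q \<in> nearest S v'"
    by (auto simp: assms(2,4))
  have k: "k < E" using assms(1) by (simp add: triad_def)
  then have "?P \<noteq> ?Q" using ridge(3)[OF k] by (simp add: adjacent_def)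
  have dists: "dist v ?P = dist v ?Q" "dist v' ?P = dist v' ?Q"
    using near by (auto intro: nearest_dist_eq)
  have diff: "x - y = u * cnj (x - y)" if "x = a + u * cnj x" "y = a + u * cnj y" for x y a u :: complex
  proof -
    have "x - y = (a + u * cnj x) - (a + u * cnj y)" using that by argo
    then show ?thesis by (simp add: algebra_simps)
  qed
  have "cpx ?P - cpx v = ?u * cnj (cpx ?P - cpx v)"
    by (rule diff[OF triad_generator[OF assms(1)] triad_centre[OF assms(1,2)]])
  moreover have "cpx ?P - cpx v' = ?u * cnj (cpx ?P - cpx v')"
    unfolding eq by (rule diff[OF triad_generator[OF assms(3)] triad_centre[OF assms(3,4)]])
  moreover have "cpx ?P - cpx v \<noteq> 0"
    using dists(1) \<open>?P \<noteq> ?Q\<close> by auto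
  ultimately have "Im ((cpx ?P - cpx v') * cnj (cpx ?P - cpx v)) = 0"
    by (rule fixed_lines_collinear)
  then have "cross2 (v' - v) (?P - v) = 0"
    by (simp add: cross2_def algebra_simps)
  then obtain c where "?P - v = c *\<^sub>R (v' - v)"
    using cross2_eq_0_scale[of "v' - v" "?P - v"] assms(5) by auto
  moreover have "(v' - v) \<bullet> (?Q - ?P) = 0"
    using dists by (simp add: dist_eq_iff inner_diff_left)
  ultimately have "(?P - v) \<bullet> (?Q - ?P) = 0" by simp
  moreover have "2 * ((?P - v) \<bullet> (?Q - ?P)) = - ((?Q - ?P) \<bullet> (?Q - ?P))"
    using dists(1) by (simp add: dist_eq_iff inner_diff inner_commute)
  ultimately show False using \<open>?P \<noteq> ?Q\<close> by simp
qed

text \<open>What the search for a first generator exploits: around either side of \<open>k\<close>, the two ridges next to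
  \<open>k\<close> lead to the cells \<open>r\<close> and \<open>r'\<close>, in some order, and the two chains through \<open>r\<close> and \<open>r'\<close> have
  different linear parts.\<close>

definition "seed_ridge k r r' \<longleftrightarrow> k < E \<and> r \<noteq> r' \<and>
  (\<forall>c \<in> {s1 k, s2 k}. 3 \<le> length (cells T ! c) \<and>
     (\<forall>m < E. c \<in> {s1 m, s2 m} \<longrightarrow> m \<noteq> k \<longrightarrow> touching k m \<longrightarrow> other c m \<in> {r, r'})) \<and>
  (\<forall>m l m' l'. triad k m l r \<longrightarrow> triad k m' l' r' \<longrightarrow> turn_u k m l \<noteq> turn_u k m' l')"

text \<open>A lone site would have the whole plane as its cell, so connectedness yields a neighbour; a ray
  does not fit into a bounded cell.\<close>

lemma bounded_cell_ridge:
  assumes "P \<in> S" "bounded (voronoi_cell S P)"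
  obtains k a b where "k < E" "P \<in> {p (s1 k), p (s2 k)}" "gm k = Segment a b"
proof -
  obtain i where i: "i < n" "p i = P" using assms(1) p_bij by (auto simp: bij_betw_def)
  have "S \<noteq> {P}"
  proof
    assume "S = {P}"
    then have "voronoi_cell S P = UNIV" by (auto simp: voronoi_cell_def)
    with assms(2) show False by simp
  qed
  then obtain Q where "adjacent S P Q" "Q \<in> S"
    using adjacent_crossing[OF fin, of "{P}"] assms(1) by auto
  moreover from \<open>Q \<in> S\<close> obtain j where j: "j < n" "p j = Q" using p_bij by (auto simp: bij_betw_def)
  ultimately obtain k where k: "k < E" "{s1 k, s2 k} = {i, j}"
    using ridge_exists[of i j] i by auto
  then have P: "P \<in> {p (s1 k), p (s2 k)}" using i by (auto simp: doubleton_eq_iff)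
  have "ridge_points (gm k) \<subseteq> voronoi_cell S P"
    using ridge(4)[OF k(1)] P by (auto simp: shared_boundary_def)
  then have "bounded (ridge_points (gm k))" using assms(2) bounded_subset by blast
  then have "gm k \<noteq> Ray a d" for a d
    using bounded_ray_imp_0[of a d] ridge_nontrivial[OF k(1)] by auto
  then obtain a b where "gm k = Segment a b" by (cases "gm k") auto
  with that k(1) P show ?thesis by blast
qed

text \<open>Any ridge of the given cell will do. Its ends have exactly one further nearest site each, \<open>R\<close> and
  \<open>R'\<close>, and these differ since a circle is determined by three of its points. A ridge of either side
  that shares an end with \<open>k\<close> can only lead to \<open>R\<close> or \<open>R'\<close>.\<close>

lemma ex_seed_ridge:
  assumes "P \<in> S" "bounded (voronoi_cell S P)" "nondegenerate_cell S P"
  obtains k r r' where "seed_ridge k r r'"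
proof -
  obtain k a b where k: "k < E" and P: "P \<in> {p (s1 k), p (s2 k)}" and g: "gm k = Segment a b"
    using bounded_cell_ridge[OF assms(1,2)] by blast
  let ?P = "p (s1 k)" and ?Q = "p (s2 k)"
  have nd: "nondegenerate_cell S ?P \<or> nondegenerate_cell S ?Q" using assms(3) P by auto
  have e: "ridge_end S ?P ?Q a (b - a)" "ridge_end S ?P ?Q b (a - b)"
    using ridge_end_base[OF k] ridge_end_tip[OF k g] g by simp_all
  have "a \<noteq> b" "?P \<noteq> ?Q" using e by (auto simp: ridge_end_def)
  obtain R where R: "R \<noteq> ?P" "R \<noteq> ?Q" "nearest S a = {?P, ?Q, R}"
    using nondegenerate_ridge_end[OF fin e(1) nd] by blast
  obtain R' where R': "R' \<noteq> ?P" "R' \<noteq> ?Q" "nearest S b = {?P, ?Q, R'}"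
    using nondegenerate_ridge_end[OF fin e(2) nd] by blast
  have "R \<in> nearest S a" "R' \<in> nearest S b" unfolding R(3) R'(3) by simp_all
  then have "R \<in> S" "R' \<in> S" by (auto simp: nearest_def)
  then obtain r r' where r: "r < n" "p r = R" "r' < n" "p r' = R'"
    using p_bij by (auto simp: bij_betw_def)
  have "R \<noteq> R'"
  proof
    assume "R = R'"
    then have "dist a ?P = dist a R" "dist b ?P = dist b R"
      using R(3) R'(3) by (auto intro!: nearest_dist_eq[of _ S])
    then have "(b - a) \<bullet> (R - ?P) = 0" by (simp add: dist_eq_iff inner_diff_left)
    moreover have "(b - a) \<bullet> (?Q - ?P) = 0" using ridge_end_perp[OF e(1)] .
    moreover have "cross2 (?Q - ?P) (R - ?P) \<noteq> 0"
      using R \<open>?P \<noteq> ?Q\<close> by (intro nearest_not_collinear[of _ S a]) auto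
    ultimately show False using perp_both_0[of "?Q - ?P" "R - ?P" "b - a"] \<open>a \<noteq> b\<close> by auto
  qed
  then have "r \<noteq> r'" using r by auto
  have corner: "3 \<le> length (cells T ! c) \<and>
     (\<forall>m < E. c \<in> {s1 m, s2 m} \<longrightarrow> m \<noteq> k \<longrightarrow> touching k m \<longrightarrow> other c m \<in> {r, r'})"
    if c: "c \<in> {s1 k, s2 k}" for c
  proof
    let ?o = "other c k"
    have o: "{s1 k, s2 k} = {c, ?o}" "?o \<noteq> c" "?o < n" using other[OF k c] by auto
    have cn: "c < n" using c ridge[OF k] by auto
    have sites: "{?P, ?Q} = {p c, p ?o}" using o(1) by (metis image_insert image_empty)
    have na: "nearest S a = {p c, p ?o, p r}" "nearest S b = {p c, p ?o, p r'}"
    proof -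
      have "nearest S a = {?P, ?Q} \<union> {p r}" "nearest S b = {?P, ?Q} \<union> {p r'}"
        using R(3) R'(3) r by auto
      then show "nearest S a = {p c, p ?o, p r}" "nearest S b = {p c, p ?o, p r'}"
        unfolding sites by auto
    qed
    have ne: "r \<noteq> c" "r \<noteq> ?o" "r' \<noteq> c" "r' \<noteq> ?o"
    proof -
      have "p r \<notin> {?P, ?Q}" "p r' \<notin> {?P, ?Q}" using R(1,2) R'(1,2) r by auto
      then show "r \<noteq> c" "r \<noteq> ?o" "r' \<noteq> c" "r' \<noteq> ?o" unfolding sites by auto
    qed
    have pne: "p c \<noteq> p ?o" "p c \<noteq> p r" "p c \<noteq> p r'" "p ?o \<noteq> p r" "p ?o \<noteq> p r'"
      using ne o(2,3) cn r(1,3) p_inj by metis+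
    have "adjacent S (p c) (p r)" "adjacent S (p c) (p r')"
      using three_nearest_adjacent[OF fin na(1) pne(1,2,4)] three_nearest_adjacent[OF fin na(2) pne(1,3,5)] .
    then obtain k1 k2 where k12: "k1 < E" "{s1 k1, s2 k1} = {c, r}" "k2 < E" "{s1 k2, s2 k2} = {c, r'}"
      using ridge_exists[OF cn] r by metis
    have "{k, k1, k2} \<subseteq> set (cells T ! c)"
      using k k12 c cell_ridges(2)[OF cn] by auto
    then have "card {k, k1, k2} \<le> length (cells T ! c)"
      by (metis card_mono finite_set card_length order_trans)
    moreover have "k \<noteq> k1" "k \<noteq> k2" "k1 \<noteq> k2"
      using k12 o(1) ne \<open>r \<noteq> r'\<close> by (auto simp: doubleton_eq_iff)
    ultimately show "3 \<le> length (cells T ! c)" by simp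
    show "\<forall>m < E. c \<in> {s1 m, s2 m} \<longrightarrow> m \<noteq> k \<longrightarrow> touching k m \<longrightarrow> other c m \<in> {r, r'}"
    proof (intro allI impI)
      fix m assume m: "m < E" "c \<in> {s1 m, s2 m}" "m \<noteq> k" "touching k m"
      have om: "{s1 m, s2 m} = {c, other c m}" "other c m \<noteq> c" "other c m < n" using other[OF m(1,2)] by auto
      have "other c m \<noteq> ?o" using other_inj[OF m(1,2) k c] m(3) by auto
      have near: "p (other c m) \<in> nearest S v" if "Some v \<in> ridge_ends (gm m)" for v
      proof -
        have "v \<in> shared_boundary S (p (s1 m)) (p (s2 m))"
          using ridge_ends_in_points[OF that] ridge(4)[OF m(1)] by simp
        then have "p (s1 m) \<in> nearest S v" "p (s2 m) \<in> nearest S v"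
          using ridge[OF m(1)] p_in_S by (auto intro: shared_nearest)
        then show ?thesis by (auto simp: other_def)
      qed
      have "Some a \<in> ridge_ends (gm m) \<or> Some b \<in> ridge_ends (gm m)"
        using m(4) g by (auto simp: touching_def)
      then have "p (other c m) \<in> nearest S a \<union> nearest S b"
        using near by blast
      then have "p (other c m) \<in> {p c, p ?o, p r, p r'}" unfolding na by blast
      then have "other c m \<in> {c, ?o, r, r'}"
        using om(3) cn o(3) r(1,3) by (simp add: p_inj)
      then show "other c m \<in> {r, r'}" using om(2) \<open>other c m \<noteq> ?o\<close> by blast
    qed
  qed
  have "seed_ridge k r r'"
    unfolding seed_ridge_def
  proof (intro conjI ballI allI impI)
    fix m l m' l' assume "triad k m l r" "triad k m' l' r'"
    then show "turn_u k m l \<noteq> turn_u k m' l'"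
      using turns_differ[of k m l r a m' l' r' b] R(3) R'(3) r \<open>a \<noteq> b\<close> by simp
  qed (use k \<open>r \<noteq> r'\<close> corner in blast)+
  with that show ?thesis by blast
qed

end

section \<open>Running programs of the real RAM\<close>

text \<open>On loop-free programs, execution is the function \<open>step\<close> and its cost is at most \<open>max_cost\<close>, whatever
  the state. Constants in time bounds are expressed by \<open>max_cost\<close> and never computed.\<close>

primrec loop_free :: "com \<Rightarrow> bool" where
  "loop_free Skip \<longleftrightarrow> True"
| "loop_free (NSet a e f) \<longleftrightarrow> True"
| "loop_free (RSet a e f) \<longleftrightarrow> True"
| "loop_free (Seq c d) \<longleftrightarrow> loop_free c \<and> loop_free d"
| "loop_free (Cond b c d) \<longleftrightarrow> loop_free c \<and> loop_free d"
| "loop_free (While b c) \<longleftrightarrow> False"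

primrec step :: "com \<Rightarrow> state \<Rightarrow> state" where
  "step Skip s = s"
| "step (NSet a e f) s = s\<lparr>nats := (nats s)(a := (nats s a)(nval e s := nval f s))\<rparr>"
| "step (RSet a e f) s = s\<lparr>reals := (reals s)(a := (reals s a)(nval e s := rval f s))\<rparr>"
| "step (Seq c d) s = step d (step c s)"
| "step (Cond b c d) s = (if holds b s then step c s else step d s)"
| "step (While b c) s = s"

primrec max_cost :: "com \<Rightarrow> nat" where
  "max_cost Skip = 1"
| "max_cost (NSet a e f) = ncost e + ncost f + 1"
| "max_cost (RSet a e f) = ncost e + rcost f + 1"
| "max_cost (Seq c d) = max_cost c + max_cost d"
| "max_cost (Cond b c d) = tcost b + max (max_cost c) (max_cost d) + 1"
| "max_cost (While b c) = 0"

primrec nat_writes :: "com \<Rightarrow> string set" where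
  "nat_writes Skip = {}"
| "nat_writes (NSet a e f) = {a}"
| "nat_writes (RSet a e f) = {}"
| "nat_writes (Seq c d) = nat_writes c \<union> nat_writes d"
| "nat_writes (Cond b c d) = nat_writes c \<union> nat_writes d"
| "nat_writes (While b c) = nat_writes c"

primrec real_writes :: "com \<Rightarrow> string set" where
  "real_writes Skip = {}"
| "real_writes (NSet a e f) = {}"
| "real_writes (RSet a e f) = {a}"
| "real_writes (Seq c d) = real_writes c \<union> real_writes d"
| "real_writes (Cond b c d) = real_writes c \<union> real_writes d"
| "real_writes (While b c) = real_writes c"

lemma exec_step:
  "loop_free c \<Longrightarrow> \<exists>t \<le> max_cost c. exec c s t (step c s)"
proof (induction c arbitrary: s)
  case (Seq c d)
  then obtain t u where "t \<le> max_cost c" "exec c s t (step c s)"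
    "u \<le> max_cost d" "exec d (step c s) u (step d (step c s))" by fastforce
  then show ?case by (auto intro!: exI[of _ "t + u"] exec.Seq)
next
  case (Cond b c d)
  show ?case
  proof (cases "holds b s")
    case True
    from Cond obtain t where "t \<le> max_cost c" "exec c s t (step c s)" by fastforce
    with True show ?thesis by (auto intro!: exI[of _ "tcost b + t + 1"] exec.CondTrue)
  next
    case False
    from Cond obtain t where "t \<le> max_cost d" "exec d s t (step d s)" by fastforce
    with False show ?thesis by (auto intro!: exI[of _ "tcost b + t + 1"] exec.CondFalse)
  qed
next
  case Skip show ?case unfolding step.simps max_cost.simps using exec.Skip by blast
next
  case (NSet a e f) show ?case unfolding step.simps max_cost.simps using exec.NSet by blast
next
  case (RSet a e f) show ?case unfolding step.simps max_cost.simps using exec.RSet by blast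
qed simp

lemma nats_step: "a \<notin> nat_writes c \<Longrightarrow> nats (step c s) a = nats s a"
  by (induction c arbitrary: s) auto

lemma reals_step: "a \<notin> real_writes c \<Longrightarrow> reals (step c s) a = reals s a"
  by (induction c arbitrary: s) auto

definition runs :: "com \<Rightarrow> state \<Rightarrow> nat \<Rightarrow> (state \<Rightarrow> bool) \<Rightarrow> bool" where
  "runs c s B Q \<longleftrightarrow> (\<exists>t s'. exec c s t s' \<and> t \<le> B \<and> Q s')"

lemma runs_step: "loop_free c \<Longrightarrow> Q (step c s) \<Longrightarrow> runs c s (max_cost c) Q"
  unfolding runs_def using exec_step by blast

lemma runs_Seq:
  assumes "runs c s B Q" "\<And>s'. Q s' \<Longrightarrow> runs d s' B' R"
  shows "runs (Seq c d) s (B + B') R"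
  using assms unfolding runs_def by (meson add_mono exec.Seq)

lemma runs_While:
  assumes "loop_free c" "I s"
    and body: "\<And>s. I s \<Longrightarrow> holds b s \<Longrightarrow> I (step c s) \<and> \<mu> (step c s) < \<mu> s"
  shows "runs (While b c) s ((tcost b + max_cost c + 1) * (\<mu> s + 1)) (\<lambda>s'. I s' \<and> \<not> holds b s')"
  using assms(2)
proof (induction "\<mu> s" arbitrary: s rule: less_induct)
  case less
  let ?w = "tcost b + max_cost c + 1"
  show ?case
  proof (cases "holds b s")
    case False
    then have "exec (While b c) s (tcost b + 1) s" by (rule exec.WhileFalse)
    moreover have "tcost b + 1 \<le> ?w * (\<mu> s + 1)" by simp
    ultimately show ?thesis using less.prems False unfolding runs_def by blast
  next
    case True
    note I = body[OF less.prems True]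
    obtain t where t: "t \<le> max_cost c" "exec c s t (step c s)" using exec_step[OF assms(1)] by blast
    obtain u s' where u: "exec (While b c) (step c s) u s'" "u \<le> ?w * (\<mu> (step c s) + 1)"
      "I s'" "\<not> holds b s'"
      using less.hyps[of "step c s"] I unfolding runs_def by blast
    have "?w * (\<mu> (step c s) + 1) \<le> ?w * \<mu> s" using I by (intro mult_le_mono2) simp
    then have "tcost b + t + u + 1 \<le> ?w * (\<mu> s + 1)" using t u by simp
    with exec.WhileTrue[OF True t(2) u(1)] u(3,4) show ?thesis unfolding runs_def by blast
  qed
qed

text \<open>Points of the plane are handled as complex numbers: pairs of real expressions, stored in pairs
  of arrays.\<close>

type_synonym cexp = "rexp \<times> rexp"

definition cval :: "cexp \<Rightarrow> state \<Rightarrow> complex" where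
  "cval e s = Complex (rval (fst e) s) (rval (snd e) s)"

definition cget :: "string \<Rightarrow> string \<Rightarrow> nexp \<Rightarrow> cexp" where
  "cget x y i = (RGet x i, RGet y i)"

definition cadd :: "cexp \<Rightarrow> cexp \<Rightarrow> cexp" where
  "cadd e f = (RAdd (fst e) (fst f), RAdd (snd e) (snd f))"

definition csub :: "cexp \<Rightarrow> cexp \<Rightarrow> cexp" where
  "csub e f = (RSub (fst e) (fst f), RSub (snd e) (snd f))"

definition cmul :: "cexp \<Rightarrow> cexp \<Rightarrow> cexp" where
  "cmul e f = (RSub (RMul (fst e) (fst f)) (RMul (snd e) (snd f)),
               RAdd (RMul (fst e) (snd f)) (RMul (snd e) (fst f)))"

definition ccnj :: "cexp \<Rightarrow> cexp" where
  "ccnj e = (fst e, RSub (RConst 0) (snd e))"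

definition cdiv :: "cexp \<Rightarrow> cexp \<Rightarrow> cexp" where
  "cdiv e f = (RDiv (fst (cmul e (ccnj f))) (fst (cmul f (ccnj f))),
               RDiv (snd (cmul e (ccnj f))) (fst (cmul f (ccnj f))))"

definition ceq :: "cexp \<Rightarrow> cexp \<Rightarrow> test" where
  "ceq e f = Conj (REq (fst e) (fst f)) (REq (snd e) (snd f))"

definition cset :: "string \<Rightarrow> string \<Rightarrow> nexp \<Rightarrow> cexp \<Rightarrow> com" where
  "cset x y i e = Seq (RSet x i (fst e)) (RSet y i (snd e))"

definition mem :: "state \<Rightarrow> string \<Rightarrow> string \<Rightarrow> nat \<Rightarrow> complex" where
  "mem s x y i = Complex (reals s x i) (reals s y i)"

lemma rval_fst_snd: "rval (fst e) s = Re (cval e s)" "rval (snd e) s = Im (cval e s)"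
  by (simp_all add: cval_def)

lemma cval_simps [simp]:
  "cval (cget x y i) s = mem s x y (nval i s)"
  "cval (cadd e f) s = cval e s + cval f s"
  "cval (csub e f) s = cval e s - cval f s"
  "cval (cmul e f) s = cval e s * cval f s"
  "cval (ccnj e) s = cnj (cval e s)"
  by (simp_all add: complex_eq_iff cval_def cget_def cadd_def csub_def cmul_def ccnj_def mem_def)

text \<open>Symbolic execution observes single arrays and leaves states folded. Unfolding the states instead
  would multiply the branches of successive conditionals.\<close>

lemma nats_observe [simp]:
  "nats (step Skip s) a = nats s a"
  "nats (step (NSet b e f) s) a = (if a = b then (nats s b)(nval e s := nval f s) else nats s a)"
  "nats (step (RSet b e' f') s) a = nats s a"
  "nats (step (Seq c d) s) a = nats (step d (step c s)) a"
  "nats (step (Cond t c d) s) a = (if holds t s then nats (step c s) a else nats (step d s) a)"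
  by simp_all

lemma mem_observe [simp]:
  "mem (step Skip s) x y = mem s x y"
  "mem (step (NSet b e f) s) x y = mem s x y"
  "mem (step (Seq c d) s) x y = mem (step d (step c s)) x y"
  "mem (step (Cond t c d) s) x y = (if holds t s then mem (step c s) x y else mem (step d s) x y)"
  by (simp_all add: mem_def fun_eq_iff)

declare step.simps [simp del]

lemma cval_cdiv [simp]: "cval (cdiv e f) s = cval e s / cval f s"
proof -
  let ?a = "cval e s" and ?b = "cval f s"
  have "Re (?b * cnj ?b) = (cmod ?b)\<^sup>2" by (simp flip: complex_norm_square)
  moreover have "cval (cdiv e f) s =
      Complex (Re (?a * cnj ?b) / Re (?b * cnj ?b)) (Im (?a * cnj ?b) / Re (?b * cnj ?b))"
    by (subst cval_def) (simp only: cdiv_def fst_conv snd_conv rval.simps rval_fst_snd cval_simps)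
  ultimately show ?thesis
    by (simp only: complex_div_cnj[of ?a ?b] complex_eq_iff complex.sel Re_divide_of_real Im_divide_of_real)
qed

lemma holds_ceq [simp]: "holds (ceq e f) s \<longleftrightarrow> cval e s = cval f s"
  by (simp add: ceq_def rval_fst_snd complex_eq_iff)

lemma loop_free_cset [simp]: "loop_free (cset x y i e)"
  by (simp add: cset_def)

lemma writes_cset [simp]: "nat_writes (cset x y i e) = {}" "real_writes (cset x y i e) = {x, y}"
  by (auto simp: cset_def)

lemma step_cset_nats [simp]: "nats (step (cset x y i e) s) = nats s"
  by (simp add: cset_def fun_eq_iff)

lemma nval_cong: "nats s = nats s' \<Longrightarrow> nval i s = nval i s'"
  by (induction i) simp_all

text \<open>The second component of \<open>e\<close> is evaluated after the first array has been changed, whence the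
  premise \<open>fresh\<close>.\<close>

lemma mem_step_cset:
  assumes "x \<noteq> y" and fresh: "\<And>r. cval e (s\<lparr>reals := (reals s)(x := (reals s x)(nval i s := r))\<rparr>) = cval e s"
  shows "mem (step (cset x y i e) s) x y = (mem s x y)(nval i s := cval e s)"
proof -
  have i: "nval i (s\<lparr>reals := R\<rparr>) = nval i s" for R by (intro nval_cong) simp
  show ?thesis
    using assms(1) by (simp add: cset_def mem_def fun_eq_iff rval_fst_snd i fresh step.simps)
qed

lemma mem_update [simp]:
  "mem (s\<lparr>nats := N\<rparr>) = mem s"
  "x \<noteq> a \<Longrightarrow> y \<noteq> a \<Longrightarrow> mem (s\<lparr>reals := (reals s)(a := f)\<rparr>) x y = mem s x y"
  by (simp_all add: mem_def fun_eq_iff)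

lemma mem_other: "x \<notin> real_writes c \<Longrightarrow> y \<notin> real_writes c \<Longrightarrow> mem (step c s) x y = mem s x y"
  by (simp add: mem_def reals_step fun_eq_iff)

abbreviation "scalar a \<equiv> NGet a (NConst 0)"
abbreviation "set_scalar a e \<equiv> NSet a (NConst 0) e"
abbreviation "increment a \<equiv> set_scalar a (NAdd (scalar a) (NConst 1))"

section \<open>The program\<close>

text \<open>The reflection in ridge \<open>k\<close> is stored as \<open>z \<mapsto> o + u * cnj z\<close>, with \<open>o\<close> in the arrays \<open>ox\<close>, \<open>oy\<close> and \<open>u\<close>
  in \<open>ux\<close>, \<open>uy\<close>.\<close>

definition mirror_body :: com where
  "mirror_body =
    (let k = scalar ''k''; a = cget ''x1'' ''y1'' k; v = cget ''x2'' ''y2'' k;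
         d = cget ''dx'' ''dy'' (NConst 0); u = cget ''ux'' ''uy'' k in
     Seq (Cond (NEq (NGet ''is_ray'' k) (NConst 0))
            (cset ''dx'' ''dy'' (NConst 0) (csub v a))
            (cset ''dx'' ''dy'' (NConst 0) v))
    (Seq (cset ''ux'' ''uy'' k (cdiv d (ccnj d)))
    (Seq (cset ''ox'' ''oy'' k (csub a (cmul u (ccnj a))))
         (increment ''k''))))"

definition mirror_loop :: com where
  "mirror_loop = While (NLess (scalar ''k'') (scalar ''num_ridges'')) mirror_body"

lemma loop_free_mirror_body: "loop_free mirror_body"
  by (simp add: mirror_body_def Let_def)

text \<open>A nested loop over the cells \<open>c\<close> and the positions \<open>t\<close> of their lists, flattened so that the body is
  loop-free: each round advances either \<open>t\<close> or \<open>c\<close>. For each position it stores the cell across the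
  ridge and the cyclic neighbours, and for each ridge its positions in the lists of both sides.\<close>

definition link_body :: com where
  "link_body =
    (let c = scalar ''c''; t = scalar ''t''; k = NGet ''cell_ridges'' t;
         lo = NGet ''cell_start'' c; hi = NGet ''cell_start'' (NAdd c (NConst 1)) in
     Cond (NLess t hi)
      (Seq (Cond (NEq (NGet ''side1'' k) c)
              (Seq (NSet ''nbr'' t (NGet ''side2'' k)) (NSet ''pos1'' k t))
              (Seq (NSet ''nbr'' t (NGet ''side1'' k)) (NSet ''pos2'' k t)))
      (Seq (Cond (NEq (NAdd t (NConst 1)) hi) (NSet ''nxt'' t lo) (NSet ''nxt'' t (NAdd t (NConst 1))))
      (Seq (Cond (NEq t lo) (NSet ''prv'' t (NSub hi (NConst 1))) (NSet ''prv'' t (NSub t (NConst 1))))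
           (increment ''t''))))
      (increment ''c''))"

definition link_loop :: com where
  "link_loop = While (NLess (scalar ''c'') (scalar ''num_cells'')) link_body"

lemma loop_free_link_body: "loop_free link_body"
  by (simp add: link_body_def Let_def)

definition turn_uexp :: "nexp \<Rightarrow> nexp \<Rightarrow> nexp \<Rightarrow> cexp" where
  "turn_uexp k m l = (let u = cget ''ux'' ''uy'' in cmul (cmul (u l) (ccnj (u m))) (u k))"

definition turn_oexp :: "nexp \<Rightarrow> nexp \<Rightarrow> nexp \<Rightarrow> cexp" where
  "turn_oexp k m l = (let u = cget ''ux'' ''uy''; o' = cget ''ox'' ''oy'' in
     cadd (cadd (o' l) (cmul (u l) (ccnj (o' m)))) (cmul (cmul (u l) (ccnj (u m))) (o' k)))"

text \<open>For ridge \<open>e\<close>, \<open>a1\<close> and \<open>a2\<close> are the neighbouring positions around its first side, \<open>b1\<close> and \<open>b2\<close> around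
  its second side. As the lists may be oriented either way, the latter are exchanged unless \<open>b1\<close>
  already leads to the same cell as \<open>a1\<close>.\<close>

definition match_body :: com where
  "match_body =
    (let e = scalar ''e''; i = NGet ''pos1'' e; j = NGet ''pos2'' e in
     Seq (set_scalar ''a1'' (NGet ''nxt'' i))
    (Seq (set_scalar ''a2'' (NGet ''prv'' i))
    (Seq (set_scalar ''b1'' (NGet ''nxt'' j))
    (Seq (set_scalar ''b2'' (NGet ''prv'' j))
         (Cond (NEq (NGet ''nbr'' (scalar ''a1'')) (NGet ''nbr'' (scalar ''b1'')))
            Skip
            (Seq (set_scalar ''b1'' (NGet ''prv'' j)) (set_scalar ''b2'' (NGet ''nxt'' j))))))))"

definition solve_body :: com where
  "solve_body =
    (let e = scalar ''e''; ridge = (\<lambda>x. NGet ''cell_ridges'' (scalar x));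
         nbr = (\<lambda>x. NGet ''nbr'' (scalar x));
         u = turn_uexp e (ridge ''b1'') (ridge ''a1''); u' = turn_uexp e (ridge ''b2'') (ridge ''a2'');
         v = turn_oexp e (ridge ''b1'') (ridge ''a1''); v' = turn_oexp e (ridge ''b2'') (ridge ''a2'') in
     Seq (Cond (Conj (Conj (NEq (nbr ''a1'') (nbr ''b1'')) (NEq (nbr ''a2'') (nbr ''b2''))) (Neg (ceq u u')))
            (Seq (cset ''gen_x'' ''gen_y'' (NGet ''side1'' e) (ccnj (cdiv (csub v' v) (csub u u'))))
                 (set_scalar ''seed'' (NGet ''side1'' e)))
            Skip)
         (increment ''e''))"

definition seed_loop :: com where
  "seed_loop = While (NLess (scalar ''e'') (scalar ''num_ridges'')) (Seq match_body solve_body)"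

lemma loop_free_seed_body: "loop_free (Seq match_body solve_body)"
  by (simp add: match_body_def solve_body_def Let_def)

definition start_search :: com where
  "start_search =
    Seq (NSet ''order'' (NConst 0) (scalar ''seed''))
   (Seq (NSet ''visited'' (scalar ''seed'') (NConst 1))
   (Seq (set_scalar ''tail'' (NConst 1))
        (set_scalar ''t'' (NGet ''cell_start'' (scalar ''seed'')))))"

text \<open>A breadth-first search with queue \<open>order\<close>, again flattened: each round treats position \<open>t\<close> of the
  cell at the head of the queue, or advances the head.\<close>

definition search_body :: com where
  "search_body =
    (let c = NGet ''order'' (scalar ''head''); t = scalar ''t''; q = NGet ''nbr'' t;
         k = NGet ''cell_ridges'' t in
     Cond (NLess t (NGet ''cell_start'' (NAdd c (NConst 1))))
      (Seq (Cond (NEq (NGet ''visited'' q) (NConst 0))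
              (Seq (cset ''gen_x'' ''gen_y'' q
                      (cadd (cget ''ox'' ''oy'' k) (cmul (cget ''ux'' ''uy'' k) (ccnj (cget ''gen_x'' ''gen_y'' c)))))
              (Seq (NSet ''visited'' q (NConst 1))
              (Seq (NSet ''order'' (scalar ''tail'') q)
                   (increment ''tail''))))
              Skip)
           (increment ''t''))
      (Seq (increment ''head'')
           (set_scalar ''t'' (NGet ''cell_start'' c))))"

definition search_loop :: com where
  "search_loop = While (NLess (scalar ''head'') (scalar ''tail'')) search_body"

lemma loop_free_search: "loop_free start_search" "loop_free search_body"
  by (simp_all add: start_search_def search_body_def Let_def)

context voronoi_description
begin

definition "input_ok s \<longleftrightarrow> nats s ''num_cells'' 0 = n \<and> nats s ''num_ridges'' 0 = E \<and>
  (\<forall>i \<le> n. nats s ''cell_start'' i = start i) \<and> (\<forall>t < start n. nats s ''cell_ridges'' t = ridge_at t) \<and>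
  (\<forall>k < E. nats s ''side1'' k = s1 k \<and> nats s ''side2'' k = s2 k \<and> nats s ''is_ray'' k = is_ray (gm k) \<and>
     mem s ''x1'' ''y1'' k = cpx (geom_vec1 (gm k)) \<and> mem s ''x2'' ''y2'' k = cpx (geom_vec2 (gm k)))"

definition "mirrors K s \<longleftrightarrow>
  (\<forall>k < K. mem s ''ux'' ''uy'' k = mirror_u k \<and> mem s ''ox'' ''oy'' k = mirror_o k)"

text \<open>The results of \<open>link_body\<close> for the positions before \<open>t0\<close>. For \<open>pos1\<close> and \<open>pos2\<close> it says only that the
  stored position is a valid one, so that later writes cannot destroy it.\<close>

definition "linked t0 s \<longleftrightarrow> (\<forall>c t. in_cell c t \<longrightarrow> t < t0 \<longrightarrow>
  nats s ''nbr'' t = other c (ridge_at t) \<and> nats s ''nxt'' t = next_pos c t \<and> nats s ''prv'' t = prev_pos c t \<and>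
  (let q = (if s1 (ridge_at t) = c then nats s ''pos1'' (ridge_at t) else nats s ''pos2'' (ridge_at t)) in
     in_cell c q \<and> ridge_at q = ridge_at t))"

lemma input_ok_input_state: "input_ok (input_state T)"
  by (auto simp: input_ok_def input_state_def array_def start_def ridge_at_def mem_def cpx_def
      simp del: upt_Suc)

lemma input_ok_step:
  assumes "input_ok s" "{''num_cells'', ''num_ridges'', ''cell_start'', ''cell_ridges'',
      ''side1'', ''side2'', ''is_ray''} \<inter> nat_writes c = {}" "{''x1'', ''y1'', ''x2'', ''y2''} \<inter> real_writes c = {}"
  shows "input_ok (step c s)"
  using assms unfolding input_ok_def by (simp add: nats_step mem_other)

lemma mirrors_step:
  assumes "mirrors K s" "{''ux'', ''uy'', ''ox'', ''oy''} \<inter> real_writes c = {}"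
  shows "mirrors K (step c s)"
  using assms unfolding mirrors_def by (simp add: mem_other)

lemma mirror_body_correct:
  assumes "input_ok s" "mirrors (nats s ''k'' 0) s" "nats s ''k'' 0 < E"
  shows "input_ok (step mirror_body s)" "mirrors (nats (step mirror_body s) ''k'' 0) (step mirror_body s)"
    "nats (step mirror_body s) ''k'' 0 = Suc (nats s ''k'' 0)"
proof -
  show "input_ok (step mirror_body s)"
    by (rule input_ok_step[OF assms(1)]) (simp_all add: mirror_body_def Let_def)
  show k: "nats (step mirror_body s) ''k'' 0 = Suc (nats s ''k'' 0)"
    by (simp add: mirror_body_def Let_def)
  let ?k = "nats s ''k'' 0"
  have geo: "mem s ''x1'' ''y1'' ?k = cpx (geom_vec1 (gm ?k))"
    "cpx (ridge_dir (gm ?k)) =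
       mem s ''x2'' ''y2'' ?k - (if nats s ''is_ray'' ?k = 0 then mem s ''x1'' ''y1'' ?k else 0)"
    using assms(1,3) by (cases "gm ?k"; simp add: input_ok_def)+
  have "mem (step mirror_body s) ''ux'' ''uy'' = (mem s ''ux'' ''uy'')(?k := mirror_u ?k)"
    "mem (step mirror_body s) ''ox'' ''oy'' = (mem s ''ox'' ''oy'')(?k := mirror_o ?k)"
    using geo by (simp_all add: mirror_body_def Let_def mem_step_cset mem_other mirror_u_def mirror_o_def split: if_splits)
  with assms(2) show "mirrors (nats (step mirror_body s) ''k'' 0) (step mirror_body s)"
    unfolding k by (auto simp: mirrors_def less_Suc_eq)
qed

lemma linked_step:
  assumes "linked t0 s" "{''nbr'', ''nxt'', ''prv'', ''pos1'', ''pos2''} \<inter> nat_writes c = {}"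
  shows "linked t0 (step c s)"
proof -
  have same: "nats (step c s) ''nbr'' = nats s ''nbr''" "nats (step c s) ''nxt'' = nats s ''nxt''"
    "nats (step c s) ''prv'' = nats s ''prv''" "nats (step c s) ''pos1'' = nats s ''pos1''"
    "nats (step c s) ''pos2'' = nats s ''pos2''"
    using assms(2) by (simp_all add: nats_step)
  show ?thesis using assms(1) unfolding linked_def same .
qed

lemma in_cell_unique:
  assumes "in_cell c t" "in_cell c' t"
  shows "c = c'"
proof (rule ccontr)
  assume "c \<noteq> c'"
  then consider "Suc c \<le> c'" | "Suc c' \<le> c" by linarith
  then show False using assms start_mono unfolding in_cell_def by cases fastforce+
qed

lemma link_body_next:
  assumes input_ok: "input_ok s" and L: "linked (nats s ''t'' 0) s" and t: "in_cell (nats s ''c'' 0) (nats s ''t'' 0)"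
  shows "linked (Suc (nats s ''t'' 0)) (step link_body s)"
    "nats (step link_body s) ''t'' 0 = Suc (nats s ''t'' 0)"
    "nats (step link_body s) ''c'' 0 = nats s ''c'' 0"
proof -
  let ?t = "nats s ''t'' 0" and ?c = "nats s ''c'' 0"
  let ?s = "step link_body s"
  define k where "k = ridge_at ?t"
  have c: "?c < n" "?t < start (Suc ?c)" "start ?c \<le> ?t" using t by (auto simp: in_cell_def)
  then have "?t < start n" using start_mono[of "Suc ?c" n] by simp
  then have [simp]: "nats s ''cell_ridges'' ?t = k" "nats s ''cell_start'' ?c = start ?c"
    "nats s ''cell_start'' (Suc ?c) = start (Suc ?c)"
    using input_ok c by (auto simp: input_ok_def k_def)
  have k: "k < E" "?c \<in> {s1 k, s2 k}" using ridge_at_in_cell[OF t] by (auto simp: k_def)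
  then have [simp]: "nats s ''side1'' k = s1 k" "nats s ''side2'' k = s2 k"
    using input_ok by (auto simp: input_ok_def)
  have new: "nats ?s ''nbr'' = (nats s ''nbr'')(?t := other ?c k)"
    "nats ?s ''nxt'' = (nats s ''nxt'')(?t := next_pos ?c ?t)"
    "nats ?s ''prv'' = (nats s ''prv'')(?t := prev_pos ?c ?t)"
    "nats ?s ''pos1'' = (if s1 k = ?c then (nats s ''pos1'')(k := ?t) else nats s ''pos1'')"
    "nats ?s ''pos2'' = (if s1 k = ?c then nats s ''pos2'' else (nats s ''pos2'')(k := ?t))"
    using c
    by (simp_all add: link_body_def Let_def other_def next_pos_def prev_pos_def)
  show "nats ?s ''t'' 0 = Suc ?t" "nats ?s ''c'' 0 = ?c"
    using c by (simp_all add: link_body_def Let_def)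
  show "linked (Suc ?t) ?s"
    unfolding linked_def
  proof (intro allI impI)
    fix c' t' assume t': "in_cell c' t'" "t' < Suc ?t"
    show "nats ?s ''nbr'' t' = other c' (ridge_at t') \<and> nats ?s ''nxt'' t' = next_pos c' t' \<and>
      nats ?s ''prv'' t' = prev_pos c' t' \<and>
      (let q = (if s1 (ridge_at t') = c' then nats ?s ''pos1'' (ridge_at t') else nats ?s ''pos2'' (ridge_at t')) in
         in_cell c' q \<and> ridge_at q = ridge_at t')"
    proof (cases "t' = ?t")
      case True
      then have "c' = ?c" using in_cell_unique t t'(1) by blast
      with True t show ?thesis by (simp add: new k_def Let_def)
    next
      case False
      with t' have old: "nats s ''nbr'' t' = other c' (ridge_at t')" "nats s ''nxt'' t' = next_pos c' t'"
        "nats s ''prv'' t' = prev_pos c' t'"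
        "let q = (if s1 (ridge_at t') = c' then nats s ''pos1'' (ridge_at t') else nats s ''pos2'' (ridge_at t')) in
           in_cell c' q \<and> ridge_at q = ridge_at t'"
        using L unfolding linked_def by auto
      have side: "c' \<in> {s1 (ridge_at t'), s2 (ridge_at t')}" using ridge_at_in_cell[OF t'(1)] by simp
      have "in_cell c' ?t" if "ridge_at t' = k" "(s1 k = ?c) = (s1 k = c')"
      proof -
        have "c' = ?c" using side k that sides_ne[OF k(1)] by auto
        with t show ?thesis by simp
      qed
      with False old show ?thesis by (auto simp: new Let_def k_def)
    qed
  qed
qed

lemma link_body_skip:
  assumes "input_ok s" "nats s ''c'' 0 < n" "start (Suc (nats s ''c'' 0)) \<le> nats s ''t'' 0"
  shows "step link_body s = step (increment ''c'') s"
proof -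
  have "nats s ''cell_start'' (Suc (nats s ''c'' 0)) = start (Suc (nats s ''c'' 0))"
    using assms by (auto simp: input_ok_def)
  with assms(3) show ?thesis by (simp add: link_body_def Let_def step.simps)
qed

end

section \<open>Finding a first generator\<close>

lemma nval_update_reals [simp]: "nval i (s\<lparr>reals := R\<rparr>) = nval i s"
  by (rule nval_cong) simp

lemma turn_exp_fresh [simp]:
  "cval (turn_uexp k m l) (s\<lparr>reals := (reals s)(''gen_x'' := f)\<rparr>) = cval (turn_uexp k m l) s"
  "cval (turn_oexp k m l) (s\<lparr>reals := (reals s)(''gen_x'' := f)\<rparr>) = cval (turn_oexp k m l) s"
  by (simp_all add: turn_uexp_def turn_oexp_def Let_def)

context voronoi_description begin

definition "prepared s \<longleftrightarrow> input_ok s \<and> mirrors E s \<and> linked (start n) s"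

lemma prepared_step:
  assumes "prepared s" "{''num_cells'', ''num_ridges'', ''cell_start'', ''cell_ridges'', ''side1'', ''side2'',
      ''is_ray'', ''nbr'', ''nxt'', ''prv'', ''pos1'', ''pos2''} \<inter> nat_writes c = {}"
    "{''x1'', ''y1'', ''x2'', ''y2'', ''ux'', ''uy'', ''ox'', ''oy''} \<inter> real_writes c = {}"
  shows "prepared (step c s)"
  using assms unfolding prepared_def
  by (intro conjI input_ok_step mirrors_step linked_step) simp_all

lemma prepared_linked:
  assumes "prepared s" "in_cell c t"
  shows "nats s ''nbr'' t = other c (ridge_at t)" "nats s ''nxt'' t = next_pos c t" "nats s ''prv'' t = prev_pos c t"
    "nats s ''cell_ridges'' t = ridge_at t"
    "let q = (if s1 (ridge_at t) = c then nats s ''pos1'' (ridge_at t) else nats s ''pos2'' (ridge_at t)) in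
       in_cell c q \<and> ridge_at q = ridge_at t"
proof -
  have "t < start n" using assms(2) start_mono[of "Suc c" n] by (auto simp: in_cell_def)
  with assms show "nats s ''nbr'' t = other c (ridge_at t)" "nats s ''nxt'' t = next_pos c t"
    "nats s ''prv'' t = prev_pos c t" "nats s ''cell_ridges'' t = ridge_at t"
    "let q = (if s1 (ridge_at t) = c then nats s ''pos1'' (ridge_at t) else nats s ''pos2'' (ridge_at t)) in
       in_cell c q \<and> ridge_at q = ridge_at t"
    by (auto simp: prepared_def linked_def input_ok_def)
qed

lemma prepared_pos:
  assumes "prepared s" "k < E"
  shows "in_cell (s1 k) (nats s ''pos1'' k)" "ridge_at (nats s ''pos1'' k) = k"
    "in_cell (s2 k) (nats s ''pos2'' k)" "ridge_at (nats s ''pos2'' k) = k"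
proof -
  obtain t where t: "in_cell (s1 k) t" "ridge_at t = k" using ex_in_cell[OF assms(2)] by blast
  show "in_cell (s1 k) (nats s ''pos1'' k)" "ridge_at (nats s ''pos1'' k) = k"
    using prepared_linked(5)[OF assms(1) t(1)] t(2) by (simp_all add: Let_def)
  obtain u where u: "in_cell (s2 k) u" "ridge_at u = k" using ex_in_cell[OF assms(2)] by blast
  show "in_cell (s2 k) (nats s ''pos2'' k)" "ridge_at (nats s ''pos2'' k) = k"
    using prepared_linked(5)[OF assms(1) u(1)] u(2) sides_ne[OF assms(2)] by (simp_all add: Let_def)
qed

lemma prepared_sides:
  assumes "prepared s" "k < E"
  shows "nats s ''side1'' k = s1 k" "nats s ''side2'' k = s2 k"
  using assms by (auto simp: prepared_def input_ok_def)

lemma turn_exp: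
  assumes "prepared s" "nval k s < E" "nval m s < E" "nval l s < E"
  shows "cval (turn_uexp k m l) s = turn_u (nval k s) (nval m s) (nval l s)"
    "cval (turn_oexp k m l) s = turn_o (nval k s) (nval m s) (nval l s)"
  using assms by (simp_all add: turn_uexp_def turn_oexp_def turn_u_def turn_o_def Let_def prepared_def mirrors_def)

definition "seeded s \<longleftrightarrow> nats s ''seed'' 0 < n \<and>
  mem s ''gen_x'' ''gen_y'' (nats s ''seed'' 0) = cpx (p (nats s ''seed'' 0))"

lemma triad_in_cells:
  assumes "k < E" "in_cell (s1 k) a" "in_cell (s2 k) b" "other (s1 k) (ridge_at a) = other (s2 k) (ridge_at b)"
  shows "triad k (ridge_at b) (ridge_at a) (other (s1 k) (ridge_at a))"
proof -
  note A = ridge_at_in_cell[OF assms(2)] and B = ridge_at_in_cell[OF assms(3)]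
  have "{s1 (ridge_at a), s2 (ridge_at a)} = {s1 k, other (s1 k) (ridge_at a)}"
    "{s1 (ridge_at b), s2 (ridge_at b)} = {s2 k, other (s2 k) (ridge_at b)}"
    using other[of "ridge_at a" "s1 k"] other[of "ridge_at b" "s2 k"] A B by blast+
  with A B assms(1,4) show ?thesis by (auto simp: triad_def)
qed

lemma same_pair:
  assumes "{x1, x2} = {r, r'}" "x1 \<noteq> x2" "{y1, y2} = {r, r'}" "y1 \<noteq> y2"
  shows "(if x1 = y1 then x2 = y2 else x1 = y2 \<and> x2 = y1) \<and> {x1, x2} = {r, r'}"
  using assms by (auto simp: doubleton_eq_iff)

text \<open>The last claim describes completeness: at a seed ridge the exchange in \<open>match_body\<close> makes both pairs
  of positions lead to common cells. Elsewhere only the cells containing the positions are known.\<close>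

lemma match_body_correct:
  assumes b: "prepared s" and k: "nats s ''e'' 0 < E"
  defines "k \<equiv> nats s ''e'' 0"
  defines "i \<equiv> s1 k" and "j \<equiv> s2 k"
  shows "prepared (step match_body s)" "nats (step match_body s) ''e'' 0 = k"
    "nats (step match_body s) ''seed'' 0 = nats s ''seed'' 0"
    "mem (step match_body s) ''gen_x'' ''gen_y'' = mem s ''gen_x'' ''gen_y''"
    and "\<exists>a1 a2 b1 b2. nats (step match_body s) ''a1'' 0 = a1 \<and> nats (step match_body s) ''a2'' 0 = a2 \<and>
      nats (step match_body s) ''b1'' 0 = b1 \<and> nats (step match_body s) ''b2'' 0 = b2 \<and>
      in_cell i a1 \<and> in_cell i a2 \<and> in_cell j b1 \<and> in_cell j b2 \<and>
      (\<forall>r r'. seed_ridge k r r' \<longrightarrow> other i (ridge_at a1) = other j (ridge_at b1) \<and> other i (ridge_at a2) = other j (ridge_at b2) \<and>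
         {other i (ridge_at a1), other i (ridge_at a2)} = {r, r'})"
proof -
  let ?s = "step match_body s"
  show "prepared ?s" by (rule prepared_step[OF b]) (simp_all add: match_body_def Let_def)
  show "nats ?s ''e'' 0 = k" "nats ?s ''seed'' 0 = nats s ''seed'' 0"
    by (simp_all add: match_body_def Let_def k_def)
  show "mem ?s ''gen_x'' ''gen_y'' = mem s ''gen_x'' ''gen_y''"
    by (rule mem_other) (simp_all add: match_body_def Let_def)
  have "k < E" using k by (simp add: k_def)
  define u v where "u = nats s ''pos1'' k" and "v = nats s ''pos2'' k"
  have u: "in_cell i u" "ridge_at u = k" and v: "in_cell j v" "ridge_at v = k"
    using prepared_pos[OF b \<open>k < E\<close>] by (auto simp: u_def v_def i_def j_def)
  note in_cell = in_cell_next[OF u(1)] in_cell_prev[OF u(1)] in_cell_next[OF v(1)] in_cell_prev[OF v(1)]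
  let ?x1 = "other i (ridge_at (next_pos i u))" and ?x2 = "other i (ridge_at (prev_pos i u))"
  let ?y1 = "other j (ridge_at (next_pos j v))" and ?y2 = "other j (ridge_at (prev_pos j v))"
  have corners: "{other c (ridge_at (next_pos c t)), other c (ridge_at (prev_pos c t))} = {r, r'}"
    "other c (ridge_at (next_pos c t)) \<noteq> other c (ridge_at (prev_pos c t))"
    if r: "seed_ridge k r r'" and c: "c \<in> {i, j}" and t: "in_cell c t" "ridge_at t = k" for r r' c t
  proof -
    have len: "3 \<le> length (cells T ! c)"
      and tou: "\<And>m. m < E \<Longrightarrow> c \<in> {s1 m, s2 m} \<Longrightarrow> m \<noteq> k \<Longrightarrow> touching k m \<Longrightarrow> other c m \<in> {r, r'}"
      using r c unfolding seed_ridge_def i_def j_def by blast+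
    note S = in_cell_next[OF t(1)] and P = in_cell_prev[OF t(1)] and ne = neighbours_distinct[OF t(1) len]
    have "ridge_at (next_pos c t) \<noteq> k" "ridge_at (prev_pos c t) \<noteq> k" "ridge_at (next_pos c t) \<noteq> ridge_at (prev_pos c t)"
      using ridge_at_inj[OF S t(1)] ridge_at_inj[OF P t(1)] ridge_at_inj[OF S P] ne t(2) by auto
    moreover have "touching k (ridge_at (next_pos c t))" "touching k (ridge_at (prev_pos c t))"
      using touching_next[OF t(1)] touching_prev[OF t(1)] t(2) by auto
    ultimately have mem: "other c (ridge_at (next_pos c t)) \<in> {r, r'}" "other c (ridge_at (prev_pos c t)) \<in> {r, r'}"
      using ridge_at_in_cell[OF S] ridge_at_in_cell[OF P] tou by blast+
    show ne: "other c (ridge_at (next_pos c t)) \<noteq> other c (ridge_at (prev_pos c t))"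
      using other_inj[of "ridge_at (next_pos c t)" c "ridge_at (prev_pos c t)"] ridge_at_in_cell[OF S] ridge_at_in_cell[OF P]
        \<open>ridge_at (next_pos c t) \<noteq> ridge_at (prev_pos c t)\<close> by blast
    show "{other c (ridge_at (next_pos c t)), other c (ridge_at (prev_pos c t))} = {r, r'}" using mem ne by auto
  qed
  have arrays: "nats s ''nxt'' u = next_pos i u" "nats s ''prv'' u = prev_pos i u"
    "nats s ''nxt'' v = next_pos j v" "nats s ''prv'' v = prev_pos j v"
    "nats s ''nbr'' (next_pos i u) = ?x1" "nats s ''nbr'' (next_pos j v) = ?y1"
    using prepared_linked[OF b u(1)] prepared_linked[OF b v(1)] prepared_linked(1)[OF b in_cell(1)]
      prepared_linked(1)[OF b in_cell(3)] by simp_all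
  define b1 b2 where "b1 = (if ?x1 = ?y1 then next_pos j v else prev_pos j v)"
    and "b2 = (if ?x1 = ?y1 then prev_pos j v else next_pos j v)"
  have val: "nats ?s ''a1'' 0 = next_pos i u" "nats ?s ''a2'' 0 = prev_pos i u"
    "nats ?s ''b1'' 0 = b1" "nats ?s ''b2'' 0 = b2"
    by (simp_all add: match_body_def Let_def arrays b1_def b2_def flip: k_def u_def v_def)
  have "?x1 = other j (ridge_at b1) \<and> ?x2 = other j (ridge_at b2) \<and> {?x1, ?x2} = {r, r'}"
    if r: "seed_ridge k r r'" for r r'
  proof -
    have "{?x1, ?x2} = {r, r'}" "?x1 \<noteq> ?x2" "{?y1, ?y2} = {r, r'}" "?y1 \<noteq> ?y2"
      using corners[OF r _ u] corners[OF r _ v] by simp_all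
    then have "(if ?x1 = ?y1 then ?x2 = ?y2 else ?x1 = ?y2 \<and> ?x2 = ?y1) \<and> {?x1, ?x2} = {r, r'}"
      by (rule same_pair)
    then show ?thesis by (simp add: b1_def b2_def split: if_splits)
  qed
  moreover have "in_cell j b1" "in_cell j b2" using in_cell by (simp_all add: b1_def b2_def)
  ultimately show "\<exists>a1 a2 b1 b2. nats ?s ''a1'' 0 = a1 \<and> nats ?s ''a2'' 0 = a2 \<and>
      nats ?s ''b1'' 0 = b1 \<and> nats ?s ''b2'' 0 = b2 \<and>
      in_cell i a1 \<and> in_cell i a2 \<and> in_cell j b1 \<and> in_cell j b2 \<and>
      (\<forall>r r'. seed_ridge k r r' \<longrightarrow> other i (ridge_at a1) = other j (ridge_at b1) \<and> other i (ridge_at a2) = other j (ridge_at b2) \<and>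
         {other i (ridge_at a1), other i (ridge_at a2)} = {r, r'})"
    using val in_cell(1,2) by blast
qed

text \<open>A solution is stored only when both chains close up, and then \<open>triad_generator\<close> makes it the right
  generator; later rounds may replace a seed, but only by another correct one.\<close>

lemma seed_body_correct:
  assumes b: "prepared s" and k: "nats s ''e'' 0 < E"
    and prev: "\<And>k r r'. k < nats s ''e'' 0 \<Longrightarrow> seed_ridge k r r' \<Longrightarrow> seeded s"
  defines "s' \<equiv> step (Seq match_body solve_body) s"
  shows "prepared s'" "nats s' ''e'' 0 = Suc (nats s ''e'' 0)"
    "\<And>k r r'. k < nats s' ''e'' 0 \<Longrightarrow> seed_ridge k r r' \<Longrightarrow> seeded s'"
proof -
  define k where "k = nats s ''e'' 0"
  define w where "w = step match_body s"
  note M = match_body_correct[OF b k, folded k_def w_def]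
  have s': "s' = step solve_body w" by (simp add: s'_def w_def step.simps)
  have "k < E" using k by (simp add: k_def)
  show "prepared s'" unfolding s' by (rule prepared_step[OF M(1)]) (simp_all add: solve_body_def Let_def)
  show e: "nats s' ''e'' 0 = Suc (nats s ''e'' 0)"
    unfolding s' using M(2) by (simp add: solve_body_def Let_def k_def)
  obtain a1 a2 b1 b2 where val: "nats w ''a1'' 0 = a1" "nats w ''a2'' 0 = a2" "nats w ''b1'' 0 = b1"
      "nats w ''b2'' 0 = b2"
    and cells: "in_cell (s1 k) a1" "in_cell (s1 k) a2" "in_cell (s2 k) b1" "in_cell (s2 k) b2"
    and compl: "\<And>r r'. seed_ridge k r r' \<Longrightarrow> other (s1 k) (ridge_at a1) = other (s2 k) (ridge_at b1) \<and>
         other (s1 k) (ridge_at a2) = other (s2 k) (ridge_at b2) \<and> {other (s1 k) (ridge_at a1), other (s1 k) (ridge_at a2)} = {r, r'}"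
    using M(5) by blast
  have lt: "ridge_at a1 < E" "ridge_at a2 < E" "ridge_at b1 < E" "ridge_at b2 < E" using ridge_at_in_cell cells by blast+
  note L = prepared_linked[OF M(1) cells(1)] prepared_linked[OF M(1) cells(2)]
    prepared_linked[OF M(1) cells(3)] prepared_linked[OF M(1) cells(4)]
  define match where "match \<longleftrightarrow> (other (s1 k) (ridge_at a1) = other (s2 k) (ridge_at b1) \<and>
    other (s1 k) (ridge_at a2) = other (s2 k) (ridge_at b2)) \<and> turn_u k (ridge_at b1) (ridge_at a1) \<noteq> turn_u k (ridge_at b2) (ridge_at a2)"
  define z where "z = cnj ((turn_o k (ridge_at b2) (ridge_at a2) - turn_o k (ridge_at b1) (ridge_at a1)) /
    (turn_u k (ridge_at b1) (ridge_at a1) - turn_u k (ridge_at b2) (ridge_at a2)))"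
  have res: "nats s' ''seed'' 0 = (if match then s1 k else nats s ''seed'' 0)"
    "mem s' ''gen_x'' ''gen_y'' = (if match then (mem s ''gen_x'' ''gen_y'')(s1 k := z) else mem s ''gen_x'' ''gen_y'')"
    unfolding s' using M(2,3,4) \<open>k < E\<close> lt
    by (simp_all add: solve_body_def Let_def turn_exp M(1) val L prepared_sides mem_step_cset mem_other match_def z_def)
  have "seeded s'" if match
  proof -
    have "triad k (ridge_at b1) (ridge_at a1) (other (s1 k) (ridge_at a1))" "triad k (ridge_at b2) (ridge_at a2) (other (s1 k) (ridge_at a2))"
      using that triad_in_cells[OF \<open>k < E\<close>] cells by (auto simp: match_def)
    then have "cpx (p (s1 k)) = z"
      using that unfolding z_def match_def by (blast intro: solve_generator dest: triad_generator)
    then show ?thesis using that ridge(1)[OF \<open>k < E\<close>] by (simp add: seeded_def res)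
  qed
  moreover have "seeded s' = seeded s" if "\<not> match" using that by (simp add: seeded_def res)
  moreover have match if r: "seed_ridge k r r'" for r r'
  proof -
    note c = compl[OF r]
    have tr: "triad k (ridge_at b1) (ridge_at a1) (other (s1 k) (ridge_at a1))" "triad k (ridge_at b2) (ridge_at a2) (other (s1 k) (ridge_at a2))"
      using c triad_in_cells[OF \<open>k < E\<close>] cells by blast+
    have "turn_u k m l \<noteq> turn_u k m' l'" if "triad k m l r" "triad k m' l' r'" for m l m' l'
      using r that unfolding seed_ridge_def by blast
    with tr c show ?thesis unfolding match_def doubleton_eq_iff by metis
  qed
  ultimately show "seeded s'" if "k' < nats s' ''e'' 0" "seed_ridge k' r r'" for k' r r'
    using that prev[of k' r r'] unfolding e k_def[symmetric] less_Suc_eq by blast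
qed

end

section \<open>Propagation along the adjacency graph\<close>

definition fresh :: "string set \<Rightarrow> state \<Rightarrow> bool" where
  "fresh A s \<longleftrightarrow> (\<forall>a \<in> A. nats s a = (\<lambda>_. 0))"

lemma fresh_step: "fresh A s \<Longrightarrow> A \<inter> nat_writes c = {} \<Longrightarrow> fresh A (step c s)"
  unfolding fresh_def by (metis disjoint_iff nats_step)

lemma mem_update_elsewhere [simp]:
  "x \<noteq> y \<Longrightarrow> j \<noteq> i \<Longrightarrow> mem (s\<lparr>reals := (reals s)(x := (reals s x)(i := r))\<rparr>) x y j = mem s x y j"
  by (simp add: mem_def)

context voronoi_description begin

text \<open>The queue is \<open>ord 0, \<dots>, ord (m - 1)\<close> with head at \<open>h\<close>. Its entries are the visited cells, their
  generators are known, and it contains all neighbours of the entries before the head as well as those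
  neighbours of the head that are met before position \<open>t\<close>. Once the queue is exhausted \<open>t\<close> is
  arbitrary.\<close>

definition explored :: "(nat \<Rightarrow> nat) \<Rightarrow> nat \<Rightarrow> nat \<Rightarrow> nat \<Rightarrow> (nat \<Rightarrow> nat) \<Rightarrow> (nat \<Rightarrow> complex) \<Rightarrow> bool" where
  "explored ord h m t vis gen \<longleftrightarrow> h \<le> m \<and> 0 < m \<and> inj_on ord {..<m} \<and> ord ` {..<m} \<subseteq> {..<n} \<and>
     (\<forall>c<n. vis c \<noteq> 0 \<longleftrightarrow> c \<in> ord ` {..<m}) \<and>
     (\<forall>c \<in> ord ` {..<m}. gen c = cpx (p c)) \<and>
     (\<forall>i<h. \<forall>u. in_cell (ord i) u \<longrightarrow> other (ord i) (ridge_at u) \<in> ord ` {..<m}) \<and>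
     (h < m \<longrightarrow> start (ord h) \<le> t \<and> t \<le> start (Suc (ord h)) \<and>
        (\<forall>u. in_cell (ord h) u \<longrightarrow> u < t \<longrightarrow> other (ord h) (ridge_at u) \<in> ord ` {..<m}))"

text \<open>A bound for the remaining rounds: every cell not yet passed by the head costs one round for each
  position of its list and one for leaving it, less the positions already treated at the head.\<close>

definition work :: "(nat \<Rightarrow> nat) \<Rightarrow> nat \<Rightarrow> nat \<Rightarrow> nat \<Rightarrow> nat" where
  "work ord h m t = (\<Sum>c \<in> {..<n} - ord ` {..<h}. Suc (start (Suc c) - start c)) -
     (if h < m then t - start (ord h) else 0)"

lemma explored_in_cell:
  assumes "explored ord h m t vis gen" "h < m" "t < start (Suc (ord h))"
  shows "in_cell (ord h) t"
  using assms by (auto simp: explored_def in_cell_def)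

lemma explored_old:
  assumes e: "explored ord h m t vis gen" and h: "h < m" "t < start (Suc (ord h))"
    and old: "vis (other (ord h) (ridge_at t)) \<noteq> 0"
  shows "explored ord h m (Suc t) vis gen"
proof -
  have "other (ord h) (ridge_at t) < n"
    using other ridge_at_in_cell[OF explored_in_cell[OF e h]] by blast
  then have "other (ord h) (ridge_at t) \<in> ord ` {..<m}" using e old unfolding explored_def by blast
  with e h show ?thesis unfolding explored_def less_Suc_eq by auto
qed

lemma explored_new:
  assumes e: "explored ord h m t vis gen" and h: "h < m" "t < start (Suc (ord h))"
    and new: "vis (other (ord h) (ridge_at t)) = 0"
  defines "q \<equiv> other (ord h) (ridge_at t)"
  shows "explored (ord(m := q)) h (Suc m) (Suc t) (vis(q := 1)) (gen(q := mirror (ridge_at t) (gen (ord h))))"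
proof -
  have t: "in_cell (ord h) t" by (rule explored_in_cell[OF e h])
  note c = ridge_at_in_cell[OF t]
  have q: "q < n" using other c unfolding q_def by blast
  have E: "h \<le> m" "inj_on ord {..<m}" "ord ` {..<m} \<subseteq> {..<n}"
    "\<And>c. c < n \<Longrightarrow> vis c \<noteq> 0 \<longleftrightarrow> c \<in> ord ` {..<m}" "\<And>c. c \<in> ord ` {..<m} \<Longrightarrow> gen c = cpx (p c)"
    "\<And>i u. i < h \<Longrightarrow> in_cell (ord i) u \<Longrightarrow> other (ord i) (ridge_at u) \<in> ord ` {..<m}"
    "start (ord h) \<le> t" "\<And>u. in_cell (ord h) u \<Longrightarrow> u < t \<Longrightarrow> other (ord h) (ridge_at u) \<in> ord ` {..<m}"
    using e h unfolding explored_def by blast+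
  have qnew: "q \<notin> ord ` {..<m}" using E(4)[OF q] new by (simp add: q_def)
  have img: "(ord(m := q)) ` {..<Suc m} = insert q (ord ` {..<m})"
    by (auto simp: image_iff less_Suc_eq)
  have "cpx (p q) = mirror (ridge_at t) (gen (ord h))"
    using mirror_other[of "ridge_at t" "ord h"] c E(5)[of "ord h"] h(1) by (simp add: q_def)
  moreover have "inj_on (ord(m := q)) {..<Suc m}"
    using E(2) qnew by (auto simp: inj_on_def less_Suc_eq)
  moreover have "(ord(m := q)) i = ord i" if "i < m" for i using that by simp
  ultimately show ?thesis
    unfolding explored_def img using E h q qnew
    by (simp add: less_Suc_eq) (auto simp: q_def less_Suc_eq)
qed

lemma explored_advance:
  assumes e: "explored ord h m t vis gen" and h: "h < m" "\<not> t < start (Suc (ord h))"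
    and t': "Suc h < m \<Longrightarrow> t' = start (ord (Suc h))"
  shows "explored ord (Suc h) m t' vis gen"
proof -
  have "u < t" if "in_cell (ord h) u" for u using that h by (auto simp: in_cell_def)
  moreover have "start c \<le> start (Suc c)" for c by (rule start_mono) simp
  ultimately show ?thesis
    using e h t' unfolding explored_def by (auto simp: less_Suc_eq in_cell_def)
qed

lemma work_bound:
  assumes "explored ord h m t vis gen" "h < m"
  shows "t - start (ord h) \<le> start (Suc (ord h)) - start (ord h)"
    and "(\<Sum>c \<in> {..<n} - ord ` {..<h}. Suc (start (Suc c) - start c)) =
      Suc (start (Suc (ord h)) - start (ord h)) +
      (\<Sum>c \<in> {..<n} - ord ` {..<Suc h}. Suc (start (Suc c) - start c))"
proof -
  show "t - start (ord h) \<le> start (Suc (ord h)) - start (ord h)"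
    using assms by (auto simp: explored_def)
  have "ord h \<notin> ord ` {..<h}"
  proof
    assume "ord h \<in> ord ` {..<h}"
    then obtain i where "i < h" "ord i = ord h" by auto
    moreover have "inj_on ord {..<m}" using assms(1) by (simp add: explored_def)
    ultimately show False using assms(2) inj_onD[of ord "{..<m}" i h] by simp
  qed
  moreover have "ord h < n" using assms by (auto simp: explored_def)
  moreover have "{..<n} - ord ` {..<Suc h} = ({..<n} - ord ` {..<h}) - {ord h}"
    by (auto simp: lessThan_Suc)
  ultimately show "(\<Sum>c \<in> {..<n} - ord ` {..<h}. Suc (start (Suc c) - start c)) =
      Suc (start (Suc (ord h)) - start (ord h)) +
      (\<Sum>c \<in> {..<n} - ord ` {..<Suc h}. Suc (start (Suc c) - start c))"
    by (simp add: sum.remove)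
qed

lemma work_next:
  assumes "explored ord h m t vis gen" "h < m" "t < start (Suc (ord h))"
    and "ord' ` {..<h} = ord ` {..<h}" "ord' h = ord h" "h < m'"
  shows "work ord' h m' (Suc t) < work ord h m t"
  using assms work_bound[OF assms(1,2)] unfolding work_def explored_def by auto

lemma work_advance:
  assumes "explored ord h m t vis gen" "h < m" "Suc h < m \<Longrightarrow> t' = start (ord (Suc h))"
  shows "work ord (Suc h) m t' < work ord h m t"
  using assms work_bound[OF assms(1,2)] unfolding work_def by auto

lemma sum_start: "(\<Sum>c<m. start (Suc c) - start c) = start m" if "m \<le> n" for m
  using that
proof (induction m)
  case (Suc m)
  then show ?case using start_mono[of m "Suc m"] by simp
qed simp

lemma work_start: "work ord 0 m t \<le> n + start n"
proof -
  have "work ord 0 m t \<le> (\<Sum>c<n. Suc (start (Suc c) - start c))" by (simp add: work_def)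
  also have "\<dots> = n + (\<Sum>c<n. start (Suc c) - start c)" by (simp add: sum_Suc)
  finally show ?thesis by (simp add: sum_start)
qed

text \<open>With the queue exhausted, the visited cells are closed under adjacency, so they are all cells by
  \<open>adjacent_crossing\<close>.\<close>

lemma explored_all:
  assumes e: "explored ord m m t vis gen" and c: "c < n"
  shows "gen c = cpx (p c)"
proof -
  let ?A = "ord ` {..<m}"
  have A: "?A \<subseteq> {..<n}" "?A \<noteq> {}" "\<And>c. c \<in> ?A \<Longrightarrow> gen c = cpx (p c)"
    "\<And>c u. c \<in> ?A \<Longrightarrow> in_cell c u \<Longrightarrow> other c (ridge_at u) \<in> ?A"
    using e unfolding explored_def by blast+
  have "p ` ?A = S"
  proof (rule ccontr)
    assume "p ` ?A \<noteq> S"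
    moreover have "p ` ?A \<subseteq> S" using A(1) p_in_S by auto
    ultimately obtain P Q where PQ: "P \<in> p ` ?A" "Q \<in> S - p ` ?A" "adjacent S P Q"
      using adjacent_crossing[OF fin, of "p ` ?A"] A(2) by (metis image_is_empty)
    then obtain i where i: "i \<in> ?A" "P = p i" by blast
    obtain j where j: "j < n" "Q = p j" using PQ(2) p_bij by (auto simp: bij_betw_def)
    have "i < n" using i(1) A(1) by auto
    then obtain k where k: "k < E" "{s1 k, s2 k} = {i, j}"
      using ridge_exists[of i j] j PQ(3) i(2) by auto
    then obtain u where u: "in_cell i u" "ridge_at u = k" using ex_in_cell[OF k(1), of i] by blast
    have "other i k = j" using k sides_ne[OF k(1)] by (auto simp: other_def doubleton_eq_iff)
    with A(4)[OF i(1) u(1)] u(2) PQ(2) j show False by auto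
  qed
  then obtain i where "i \<in> ?A" "p c = p i" using p_in_S[OF c] by (metis imageE)
  then have "c \<in> ?A" using A(1) p_inj[OF c] by auto
  then show ?thesis by (rule A(3))
qed

definition "searching s \<longleftrightarrow> prepared s \<and> explored (nats s ''order'') (nats s ''head'' 0) (nats s ''tail'' 0)
  (nats s ''t'' 0) (nats s ''visited'') (mem s ''gen_x'' ''gen_y'')"

lemma start_search_correct:
  assumes "prepared s" "seeded s" "fresh {''visited'', ''head''} s"
  shows "searching (step start_search s)" "nats (step start_search s) ''head'' 0 = 0"
proof -
  let ?s = "step start_search s" and ?c = "nats s ''seed'' 0"
  have c: "?c < n" "mem s ''gen_x'' ''gen_y'' ?c = cpx (p ?c)" using assms(2) by (auto simp: seeded_def)
  have "nats s ''cell_start'' ?c = start ?c" using c(1) assms(1) by (simp add: prepared_def input_ok_def)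
  then have val: "nats ?s ''order'' 0 = ?c" "nats ?s ''tail'' 0 = 1" "nats ?s ''t'' 0 = start ?c"
    "nats ?s ''visited'' = (\<lambda>_. 0)(?c := 1)" "mem ?s ''gen_x'' ''gen_y'' = mem s ''gen_x'' ''gen_y''"
    using assms(3) by (simp_all add: start_search_def fresh_def)
  show h: "nats ?s ''head'' 0 = 0" using assms(3) by (simp add: start_search_def fresh_def)
  have "prepared ?s" by (rule prepared_step[OF assms(1)]) (simp_all add: start_search_def)
  moreover have "{..<1::nat} = {0}" by auto
  then have "explored (nats ?s ''order'') 0 1 (start ?c) ((\<lambda>_. 0)(?c := 1)) (mem s ''gen_x'' ''gen_y'')"
    unfolding explored_def using c val start_mono[of ?c "Suc ?c"] by (auto simp: in_cell_def)
  ultimately show "searching ?s" unfolding searching_def val h by blast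
qed

lemma search_body_correct:
  assumes s: "searching s" and h: "nats s ''head'' 0 < nats s ''tail'' 0"
  defines "\<mu> \<equiv> \<lambda>s. work (nats s ''order'') (nats s ''head'' 0) (nats s ''tail'' 0) (nats s ''t'' 0)"
  shows "searching (step search_body s) \<and> \<mu> (step search_body s) < \<mu> s"
proof -
  let ?s = "step search_body s"
  define ord h m t vis gen where "ord = nats s ''order''" and "h = nats s ''head'' 0"
    and "m = nats s ''tail'' 0" and "t = nats s ''t'' 0" and "vis = nats s ''visited''"
    and "gen = mem s ''gen_x'' ''gen_y''"
  note defs = this
  have b: "prepared s" and e: "explored ord h m t vis gen" using s by (auto simp: searching_def defs)
  have "h < m" using h by (simp add: defs)
  have b': "prepared ?s" by (rule prepared_step[OF b]) (simp_all add: search_body_def Let_def)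
  have start: "nats s ''cell_start'' c = start c" if "c \<le> n" for c
    using b that by (simp add: prepared_def input_ok_def)
  have ordn: "ord i < n" if "i < m" for i using e that by (auto simp: explored_def)
  then have [simp]: "nats s ''cell_start'' (Suc (ord h)) = start (Suc (ord h))"
    using start[of "Suc (ord h)"] \<open>h < m\<close> by (simp add: Suc_leI)
  consider "t < start (Suc (ord h))" "vis (other (ord h) (ridge_at t)) \<noteq> 0"
    | "t < start (Suc (ord h))" "vis (other (ord h) (ridge_at t)) = 0"
    | "\<not> t < start (Suc (ord h))" by blast
  then show ?thesis
  proof cases
    case 1
    note L = prepared_linked[OF b explored_in_cell[OF e \<open>h < m\<close> 1(1)]]
    have val: "nats ?s ''order'' = ord" "nats ?s ''head'' 0 = h" "nats ?s ''tail'' 0 = m"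
      "nats ?s ''t'' 0 = Suc t" "nats ?s ''visited'' = vis" "mem ?s ''gen_x'' ''gen_y'' = gen"
      using 1 L by (simp_all add: search_body_def Let_def flip: defs)
    show ?thesis
      unfolding searching_def \<mu>_def val defs(1-4)[symmetric]
      using b' explored_old[OF e \<open>h < m\<close> 1] work_next[OF e \<open>h < m\<close> 1(1)] \<open>h < m\<close> by blast
  next
    case 2
    let ?q = "other (ord h) (ridge_at t)"
    have t: "in_cell (ord h) t" by (rule explored_in_cell[OF e \<open>h < m\<close> 2(1)])
    note L = prepared_linked[OF b t]
    have "mem s ''ux'' ''uy'' (ridge_at t) = mirror_u (ridge_at t)" "mem s ''ox'' ''oy'' (ridge_at t) = mirror_o (ridge_at t)"
      using b ridge_at_in_cell[OF t] by (auto simp: prepared_def mirrors_def)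
    moreover have "ord h \<noteq> ?q" using other ridge_at_in_cell[OF t] by metis
    ultimately have val: "nats ?s ''order'' = ord(m := ?q)" "nats ?s ''head'' 0 = h" "nats ?s ''tail'' 0 = Suc m"
      "nats ?s ''t'' 0 = Suc t" "nats ?s ''visited'' = vis(?q := 1)"
      "mem ?s ''gen_x'' ''gen_y'' = gen(?q := mirror (ridge_at t) (gen (ord h)))"
      using 2 L by (simp_all add: search_body_def Let_def mem_step_cset mem_other mirror_def flip: defs)
    have "ord(m := ?q) ` {..<h} = ord ` {..<h}" "(ord(m := ?q)) h = ord h" "h < Suc m"
      using \<open>h < m\<close> by (auto simp: image_iff)
    note w = work_next[OF e \<open>h < m\<close> 2(1) this]
    show ?thesis
      unfolding searching_def \<mu>_def val defs(1-4)[symmetric]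
      using b' explored_new[OF e \<open>h < m\<close> 2] w by blast
  next
    case 3
    have val: "nats ?s ''order'' = ord" "nats ?s ''head'' 0 = Suc h" "nats ?s ''tail'' 0 = m"
      "nats ?s ''t'' 0 = nats s ''cell_start'' (ord (Suc h))" "nats ?s ''visited'' = vis"
      "mem ?s ''gen_x'' ''gen_y'' = gen"
      using 3 by (simp_all add: search_body_def Let_def flip: defs)
    have t': "nats s ''cell_start'' (ord (Suc h)) = start (ord (Suc h))" if "Suc h < m"
      using start ordn[OF that] by simp
    show ?thesis
      unfolding searching_def \<mu>_def val defs(1-4)[symmetric]
      using b' explored_advance[OF e \<open>h < m\<close> 3 t'] work_advance[OF e \<open>h < m\<close> t'] by blast
  qed
qed

lemma run_mirror_loop:
  assumes "input_ok s" "fresh {''k'', ''c'', ''t'', ''e'', ''visited'', ''head''} s"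
  shows "runs mirror_loop s
    ((tcost (NLess (scalar ''k'') (scalar ''num_ridges'')) + max_cost mirror_body + 1) * (E + 1))
    (\<lambda>s. input_ok s \<and> mirrors E s \<and> fresh {''c'', ''t'', ''e'', ''visited'', ''head''} s)"
proof -
  let ?I = "\<lambda>s. input_ok s \<and> mirrors (nats s ''k'' 0) s \<and> nats s ''k'' 0 \<le> E \<and>
    fresh {''c'', ''t'', ''e'', ''visited'', ''head''} s"
  have n: "nats s ''num_ridges'' 0 = E" if "input_ok s" for s using that by (simp add: input_ok_def)
  have "runs mirror_loop s
    ((tcost (NLess (scalar ''k'') (scalar ''num_ridges'')) + max_cost mirror_body + 1) * ((E - nats s ''k'' 0) + 1))
    (\<lambda>s. ?I s \<and> \<not> holds (NLess (scalar ''k'') (scalar ''num_ridges'')) s)"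
    unfolding mirror_loop_def
  proof (rule runs_While[OF loop_free_mirror_body])
    show "?I s" using assms by (simp add: fresh_def mirrors_def)
    fix s assume I: "?I s" and "holds (NLess (scalar ''k'') (scalar ''num_ridges'')) s"
    then have "nats s ''k'' 0 < E" using n by simp
    with I mirror_body_correct[of s]
    have "input_ok (step mirror_body s)" "mirrors (nats (step mirror_body s) ''k'' 0) (step mirror_body s)"
      "nats (step mirror_body s) ''k'' 0 = Suc (nats s ''k'' 0)" by blast+
    moreover have "fresh {''c'', ''t'', ''e'', ''visited'', ''head''} (step mirror_body s)"
      using I by (intro fresh_step) (simp_all add: mirror_body_def Let_def)
    ultimately show "?I (step mirror_body s) \<and> E - nats (step mirror_body s) ''k'' 0 < E - nats s ''k'' 0"
      using \<open>nats s ''k'' 0 < E\<close> by simp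
  qed
  moreover have "nats s ''k'' 0 = 0" using assms(2) by (simp add: fresh_def)
  moreover have "mirrors E s" if "?I s" "\<not> holds (NLess (scalar ''k'') (scalar ''num_ridges'')) s" for s
  proof -
    have "nats s ''k'' 0 = E" using that n[of s] by simp
    with that show ?thesis by simp
  qed
  ultimately show ?thesis unfolding runs_def by auto
qed

lemma run_link_loop:
  assumes "input_ok s" "mirrors E s" "fresh {''c'', ''t'', ''e'', ''visited'', ''head''} s"
  shows "runs link_loop s
    ((tcost (NLess (scalar ''c'') (scalar ''num_cells'')) + max_cost link_body + 1) * (n + start n + 1))
    (\<lambda>s. prepared s \<and> fresh {''e'', ''visited'', ''head''} s)"
proof -
  let ?I = "\<lambda>s. input_ok s \<and> mirrors E s \<and> fresh {''e'', ''visited'', ''head''} s \<and> linked (nats s ''t'' 0) s \<and>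
    nats s ''c'' 0 \<le> n \<and> start (nats s ''c'' 0) \<le> nats s ''t'' 0 \<and>
    (nats s ''c'' 0 < n \<longrightarrow> nats s ''t'' 0 \<le> start (Suc (nats s ''c'' 0)))"
  let ?b = "NLess (scalar ''c'') (scalar ''num_cells'')"
  let ?\<mu> = "\<lambda>s. (n - nats s ''c'' 0) + (start n - nats s ''t'' 0)"
  have n: "nats s ''num_cells'' 0 = n" if "input_ok s" for s using that by (simp add: input_ok_def)
  have zero: "nats s ''c'' 0 = 0" "nats s ''t'' 0 = 0" using assms(3) by (simp_all add: fresh_def)
  have "runs link_loop s ((tcost ?b + max_cost link_body + 1) * (?\<mu> s + 1)) (\<lambda>s. ?I s \<and> \<not> holds ?b s)"
    unfolding link_loop_def
  proof (rule runs_While[OF loop_free_link_body])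
    show "?I s" using assms zero by (simp add: fresh_def linked_def)
    fix s assume I: "?I s" and "holds ?b s"
    then have c: "nats s ''c'' 0 < n" using n by simp
    let ?s = "step link_body s"
    have fr: "fresh {''e'', ''visited'', ''head''} ?s" "input_ok ?s" "mirrors E ?s"
      using I by (auto intro!: fresh_step input_ok_step mirrors_step simp: link_body_def Let_def)
    show "?I ?s \<and> ?\<mu> ?s < ?\<mu> s"
    proof (cases "nats s ''t'' 0 < start (Suc (nats s ''c'' 0))")
      case True
      then have t: "in_cell (nats s ''c'' 0) (nats s ''t'' 0)" using I c by (simp add: in_cell_def)
      note adv = link_body_next[OF _ _ t]
      have "start (Suc (nats s ''c'' 0)) \<le> start n" using c by (intro start_mono) simp
      with adv I fr c True show ?thesis by auto
    next
      case False
      then have t: "nats s ''t'' 0 = start (Suc (nats s ''c'' 0))" using I c by simp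
      have eq: "?s = step (increment ''c'') s"
        using link_body_skip[of s] I c t by simp
      have "nats ?s ''c'' 0 = Suc (nats s ''c'' 0)" "nats ?s ''t'' 0 = nats s ''t'' 0"
        by (simp_all add: eq)
      moreover have "linked (nats s ''t'' 0) ?s"
        unfolding eq using I by (intro linked_step) simp_all
      moreover have "start (Suc (nats s ''c'' 0)) \<le> start (Suc (Suc (nats s ''c'' 0)))"
        by (rule start_mono) simp
      ultimately show ?thesis using I fr c t by auto
    qed
  qed
  moreover have "prepared s" if "?I s" "\<not> holds ?b s" for s
  proof -
    have "nats s ''c'' 0 = n" using that n[of s] by simp
    with that have "start n \<le> nats s ''t'' 0" by simp
    with that show ?thesis by (auto simp: prepared_def linked_def)
  qed
  ultimately show ?thesis unfolding runs_def zero by auto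
qed

lemma run_seed_loop:
  assumes "prepared s" "fresh {''e'', ''visited'', ''head''} s" and seed: "seed_ridge k r r'"
  shows "runs seed_loop s
    ((tcost (NLess (scalar ''e'') (scalar ''num_ridges'')) + max_cost (Seq match_body solve_body) + 1) * (E + 1))
    (\<lambda>s. prepared s \<and> seeded s \<and> fresh {''visited'', ''head''} s)"
proof -
  let ?I = "\<lambda>s. prepared s \<and> nats s ''e'' 0 \<le> E \<and> fresh {''visited'', ''head''} s \<and>
    (\<forall>k r r'. k < nats s ''e'' 0 \<longrightarrow> seed_ridge k r r' \<longrightarrow> seeded s)"
  let ?b = "NLess (scalar ''e'') (scalar ''num_ridges'')"
  have n: "nats s ''num_ridges'' 0 = E" if "prepared s" for s using that by (simp add: prepared_def input_ok_def)
  have zero: "nats s ''e'' 0 = 0" using assms(2) by (simp add: fresh_def)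
  have "runs seed_loop s ((tcost ?b + max_cost (Seq match_body solve_body) + 1) * ((E - nats s ''e'' 0) + 1))
    (\<lambda>s. ?I s \<and> \<not> holds ?b s)"
    unfolding seed_loop_def
  proof (rule runs_While[OF loop_free_seed_body])
    show "?I s" using assms zero by (simp add: fresh_def)
    fix s assume I: "?I s" and "holds ?b s"
    then have e: "nats s ''e'' 0 < E" using n by simp
    let ?s = "step (Seq match_body solve_body) s"
    have "prepared ?s" "nats ?s ''e'' 0 = Suc (nats s ''e'' 0)"
      "\<And>k r r'. k < nats ?s ''e'' 0 \<Longrightarrow> seed_ridge k r r' \<Longrightarrow> seeded ?s"
      using seed_body_correct[of s] I e by blast+
    moreover have "fresh {''visited'', ''head''} ?s"
      using I by (intro fresh_step) (simp_all add: match_body_def solve_body_def Let_def)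
    ultimately show "?I ?s \<and> E - nats ?s ''e'' 0 < E - nats s ''e'' 0"
      using e by (auto simp del: nats_observe)
  qed
  moreover have "seeded s" if "?I s" "\<not> holds ?b s" for s
  proof -
    have "nats s ''e'' 0 = E" using that n[of s] by simp
    then have "k < nats s ''e'' 0" using seed by (simp add: seed_ridge_def)
    with that(1) seed show ?thesis by blast
  qed
  ultimately show ?thesis unfolding runs_def zero by auto
qed

lemma run_search_loop:
  assumes "searching s" "nats s ''head'' 0 = 0"
  shows "runs search_loop s
    ((tcost (NLess (scalar ''head'') (scalar ''tail'')) + max_cost search_body + 1) * (n + start n + 1))
    (\<lambda>s. \<forall>i<n. output_point s i = p i)"
proof -
  let ?b = "NLess (scalar ''head'') (scalar ''tail'')"
  let ?\<mu> = "\<lambda>s. work (nats s ''order'') (nats s ''head'' 0) (nats s ''tail'' 0) (nats s ''t'' 0)"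
  let ?w = "tcost ?b + max_cost search_body + 1"
  have "runs search_loop s (?w * (?\<mu> s + 1)) (\<lambda>s. searching s \<and> \<not> holds ?b s)"
    unfolding search_loop_def
    by (rule runs_While[where I = searching and \<mu> = ?\<mu>, OF loop_free_search(2) assms(1)]) (use search_body_correct in simp)
  moreover have "?w * (?\<mu> s + 1) \<le> ?w * (n + start n + 1)"
    unfolding assms(2) by (intro mult_le_mono2 add_mono work_start) simp
  moreover have "output_point s i = p i" if "searching s" "\<not> holds ?b s" "i < n" for s i
  proof -
    have e: "explored (nats s ''order'') (nats s ''head'' 0) (nats s ''tail'' 0) (nats s ''t'' 0)
        (nats s ''visited'') (mem s ''gen_x'' ''gen_y'')"
      using that(1) by (simp add: searching_def)
    moreover have "nats s ''head'' 0 = nats s ''tail'' 0" using e that(2) by (simp add: explored_def)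
    ultimately have "mem s ''gen_x'' ''gen_y'' i = cpx (p i)" using explored_all[OF _ that(3)] by metis
    then show ?thesis by (simp add: output_point_def mem_def cpx_def vec2_eq_iff)
  qed
  ultimately show ?thesis unfolding runs_def by (meson order_trans)
qed

end

definition recover_generators :: com where
  "recover_generators =
    Seq mirror_loop (Seq link_loop (Seq seed_loop (Seq start_search search_loop)))"

theorem mainTheorem2:
  shows "\<exists>(algorithm :: com) (C :: nat).
    \<forall>(S :: (real^2) set) (T :: tessellation) (p :: nat \<Rightarrow> real^2).
      finite S \<longrightarrow>
      describes_voronoi T S p \<longrightarrow>
      (\<exists>P\<in>S. bounded (voronoi_cell S P) \<and> strictly_interior S P \<and> nondegenerate_cell S P \<and>
             (\<forall>Q\<in>S. adjacent S P Q \<longrightarrow> bounded (voronoi_cell S Q))) \<longrightarrow>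
      (\<exists>t s. exec algorithm (input_state T) t s \<and>
             t \<le> C * card S \<and>
             (\<forall>i < card S. output_point s i = p i) \<and>
             output_point s ` {..<card S} = S)"
proof -
  define w1 where "w1 = tcost (NLess (scalar ''k'') (scalar ''num_ridges'')) + max_cost mirror_body + 1"
  define w2 where "w2 = tcost (NLess (scalar ''c'') (scalar ''num_cells'')) + max_cost link_body + 1"
  define w3 where "w3 = tcost (NLess (scalar ''e'') (scalar ''num_ridges'')) +
    max_cost (Seq match_body solve_body) + 1"
  define w4 where "w4 = max_cost start_search"
  define w5 where "w5 = tcost (NLess (scalar ''head'') (scalar ''tail'')) + max_cost search_body + 1"
  \<comment> \<open>from \<open>E + 1 \<le> 13 * n\<close> and \<open>n + start n + 1 \<le> 26 * n\<close>, as \<open>start n \<le> 2 * E\<close>\<close>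
  define C where "C = 13 * w1 + 26 * w2 + 13 * w3 + w4 + 26 * w5"
  have "\<exists>t s. exec recover_generators (input_state T) t s \<and> t \<le> C * card S \<and>
      (\<forall>i < card S. output_point s i = p i) \<and> output_point s ` {..<card S} = S"
    if "finite S" "describes_voronoi T S p"
      and P: "P \<in> S" "bounded (voronoi_cell S P)" "nondegenerate_cell S P" for S T p P
  proof -
    interpret voronoi_description T S p using that by unfold_locales
    obtain k r r' where seed: "seed_ridge k r r'" using ex_seed_ridge[OF P] by blast
    have fr: "fresh {''k'', ''c'', ''t'', ''e'', ''visited'', ''head''} (input_state T)"
      by (simp add: fresh_def input_state_def)
    have "runs recover_generators (input_state T)
        (w1 * (E + 1) + (w2 * (n + start n + 1) + (w3 * (E + 1) + (w4 + w5 * (n + start n + 1)))))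
        (\<lambda>s. \<forall>i<n. output_point s i = p i)"
      unfolding recover_generators_def w1_def w2_def w3_def w4_def w5_def
    proof (rule runs_Seq[OF run_mirror_loop[OF input_ok_input_state fr]], elim conjE)
      fix s assume "input_ok s" "mirrors E s" "fresh {''c'', ''t'', ''e'', ''visited'', ''head''} s"
      then show "runs (Seq link_loop (Seq seed_loop (Seq start_search search_loop))) s
          ((tcost (NLess (scalar ''c'') (scalar ''num_cells'')) + max_cost link_body + 1) * (n + start n + 1) +
           ((tcost (NLess (scalar ''e'') (scalar ''num_ridges'')) + max_cost (Seq match_body solve_body) + 1) * (E + 1) +
           (max_cost start_search +
            (tcost (NLess (scalar ''head'') (scalar ''tail'')) + max_cost search_body + 1) * (n + start n + 1))))
          (\<lambda>s. \<forall>i<n. output_point s i = p i)"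
        by (intro runs_Seq[OF run_link_loop] runs_Seq[OF run_seed_loop[OF _ _ seed]]
            runs_Seq[OF runs_step[OF loop_free_search(1), where Q = "\<lambda>s. searching s \<and> nats s ''head'' 0 = 0"]]
            run_search_loop conjI start_search_correct)
          blast+
    qed
    then obtain t s where ts: "exec recover_generators (input_state T) t s"
      "t \<le> w1 * (E + 1) + (w2 * (n + start n + 1) + (w3 * (E + 1) + (w4 + w5 * (n + start n + 1))))"
      "\<And>i. i < n \<Longrightarrow> output_point s i = p i"
      unfolding runs_def by blast
    have "n \<noteq> 0" using P(1) fin card_S by (metis card_0_eq empty_iff)
    then have "1 \<le> n" by linarith
    have "E \<le> 12 * n" using ridge_bound card_S by simp
    with \<open>1 \<le> n\<close> have "E + 1 \<le> 13 * n" "n + start n + 1 \<le> 26 * n" using half_ridges_bound by linarith+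
    then have "t \<le> w1 * (13 * n) + (w2 * (26 * n) + (w3 * (13 * n) + (w4 * n + w5 * (26 * n))))"
      using \<open>1 \<le> n\<close> by (intro order_trans[OF ts(2)] add_mono mult_le_mono2) simp_all
    also have "\<dots> = C * n" by (simp add: C_def algebra_simps)
    finally have time: "t \<le> C * n" .
    have "output_point s ` {..<n} = p ` {..<n}" using ts(3) by (intro image_cong) auto
    then have "output_point s ` {..<n} = S" using p_bij by (simp add: bij_betw_def)
    with ts(1,3) time show ?thesis unfolding card_S by blast
  qed
  then show ?thesis by blast
qed

end
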